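(* Let $P$ be a probability distribution on $\mathbb N$ with $P(1)<1$, let $n_o\sim P$, and assume $\mathbb E[e^{\theta n_o}]<\infty$ for some $\theta>0$. Let $T:L(\mathbb R_+;[0,1])\to C^1(\mathbb R_+;[0,1])$ be the operator defined in the context, let $q$ be its smallest fixed point, and let $\boldsymbol 1$ be the function identically equal to $1$. If $\beta_0>1$, then $T$ has exactly two fixed points, one of which is $q$ and the other one is $\boldsymbol 1$. Moreover, for any $f\in L(\mathbb R_+;[0,1])$ such that the set $\{x\in\mathbb R_+:f(x)<1\}$ has positive Lebesgue measure, $T^l(f)(x)\to q(x)$ as $l\to\infty$ for all $x\in\mathbb R_+$.
   Context: $\mathbb N=\{1,2,\dots\}$, $\mathbb R_+=[0,\infty)$. $L(\mathbb R_+;[0,1])$ is the set of Lebesgue measurable functions $\mathbb R_+\to[0,1]$; $C^1(\mathbb R_+;[0,1])$ the set of continuously differentiable ones. With the convention $0^0=1$, $$T(f)(x)=\frac1x\sum_{k=1}^\infty P(k)\int_{y=0}^x\left(\int_{z=0}^y\frac{e^{-z}z^{k-1}}{(k-1)!}\,dz+\int_{z=y}^\infty\frac{e^{-z}z^{k-1}}{(k-1)!}(f(z))^{k-1}\,dz\right)dy\quad(x>0),$$ $$T(f)(0)=\sum_{k=1}^\infty P(k)\int_0^\infty\frac{e^{-z}z^{k-1}}{(k-1)!}(f(z))^{k-1}\,dz.$$ The smallest fixed point $q$ is the fixed point of $T$ that is pointwise less than or equal to every fixed point of $T$; it exists and equals $\lim_{l\to\infty}T^l(\boldsymbol0)$ pointwise,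 $\boldsymbol0$ being the zero function. **$\beta_0$.** $g_2(x)=e^{-x}\sum_{k=2}^\infty P(k)\frac{x^{k-2}}{(k-2)!}$; $G_0\equiv1$, $G_i(x)=\int_{y=x}^\infty\int_{z=y}^\infty g_2(z)G_{i-1}(z)\,dz\,dy$ for $i\ge1$; $L(\beta,x)=\sum_{i\ge0}G_i(x)(-1/\beta)^i$. $\beta_0$ is the largest $\beta>0$ with $L(\beta,0)=0$. *)

theory Defs
  imports "HOL-Probability.Probability"
begin

text \<open>
  A function on the half-line \<open>[0,\<infinity>)\<close> is represented by an extensional function on
  \<open>{0..}\<close>, so that equality of functions in HOL is equality on \<open>[0,\<infinity>)\<close>. This matters
  for counting fixed points.

  All series over \<open>k \<ge> 1\<close> (or \<open>k \<ge> 2\<close>) are reindexed to start at \<open>0\<close>, which avoids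
  truncated subtraction in the exponents \<open>k - 1\<close> and \<open>k - 2\<close>.
\<close>

definition meas_funs :: "(real \<Rightarrow> real) set" where
  "meas_funs = {f \<in> {0..} \<rightarrow>\<^sub>E {0..1}. f \<in> borel_measurable (lebesgue_on {0..})}"

definition gamma_dens :: "nat \<Rightarrow> real \<Rightarrow> real" where
  "gamma_dens k z = exp (- z) * z ^ k / fact k"

definition T_op :: "nat pmf \<Rightarrow> (real \<Rightarrow> real) \<Rightarrow> (real \<Rightarrow> real)" where
  "T_op P f = (\<lambda>x\<in>{0..}.
     if x = 0 then
       (\<Sum>k. pmf P (Suc k) * (LINT z:{0..}|lebesgue. gamma_dens k z * f z ^ k))
     else
       1 / x * (\<Sum>k. pmf P (Suc k) *
         (LINT y:{0..x}|lebesgue.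
            (LINT z:{0..y}|lebesgue. gamma_dens k z) +
            (LINT z:{y..}|lebesgue. gamma_dens k z * f z ^ k))))"

definition fixed_points :: "nat pmf \<Rightarrow> (real \<Rightarrow> real) set" where
  "fixed_points P = {f \<in> meas_funs. T_op P f = f}"

definition smallest_fixed_point :: "nat pmf \<Rightarrow> (real \<Rightarrow> real)" where
  "smallest_fixed_point P =
     (THE q. q \<in> fixed_points P \<and> (\<forall>f\<in>fixed_points P. \<forall>x\<ge>0. q x \<le> f x))"

definition g2 :: "nat pmf \<Rightarrow> real \<Rightarrow> real" where
  "g2 P x = exp (- x) * (\<Sum>k. pmf P (k + 2) * x ^ k / fact k)"

primrec G :: "nat pmf \<Rightarrow> nat \<Rightarrow> real \<Rightarrow> real" where
  "G P 0 = (\<lambda>x. 1)"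
| "G P (Suc i) =
     (\<lambda>x. LINT y:{x..}|lebesgue. (LINT z:{y..}|lebesgue. g2 P z * G P i z))"

definition L :: "nat pmf \<Rightarrow> real \<Rightarrow> real \<Rightarrow> real" where
  "L P \<beta> x = (\<Sum>i. G P i x * (- 1 / \<beta>) ^ i)"

definition beta0 :: "nat pmf \<Rightarrow> real" where
  "beta0 P = (GREATEST \<beta>. \<beta> > 0 \<and> L P \<beta> 0 = 0)"

end

theory Submission
  imports Defs
begin

text \<open>
  With \<open>D(z,a) = e\<^sup>-\<^sup>z \<Sum>\<^sub>k P(k) z\<^sup>k\<^sup>-\<^sup>1/(k-1)! (1 - a\<^sup>k\<^sup>-\<^sup>1)\<close>, Tonelli's theorem turns the operator into
  \<open>x (1 - T f(x)) = \<integral> min(x,z) D(z,f(z)) dz\<close>. Here \<open>D(z,a) = (1 - a) S(z,a)\<close> with \<open>S\<close>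
  increasing in \<open>a\<close> and \<open>S(z,1) = z g\<^sub>2(z)\<close>, so in the unknown \<open>u(x) = x (1 - f(x))\<close> the operator
  is monotone and sublinear, and its linearization at \<open>u = 0\<close> has the symmetric kernel \<open>min(x,z)\<close>
  against the weight \<open>g\<^sub>2\<close>. Its largest eigenvalue is \<open>\<beta>\<^sub>0\<close>, with the nonnegative eigenfunction
  \<open>\<phi> = L(\<beta>\<^sub>0,\<cdot>)\<close>.

  Uniqueness: for a fixed point \<open>f \<noteq> 1\<close>, symmetry of the kernel gives
  \<open>\<integral> z (1 - f)(1 - q) (S(z,f) - S(z,q)) dz = 0\<close> with a nonnegative integrand; \<open>S\<close> is strictly
  increasing because \<open>\<beta>\<^sub>0 > 1\<close> excludes offspring numbers bounded by two.

  Convergence: if \<open>\<beta>\<^sub>0 > 1\<close> then \<open>w = 1 - \<epsilon> \<phi>(x)/x\<close> satisfies \<open>T w \<le> w\<close> for small \<open>\<epsilon>\<close>, and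
  \<open>T f \<le> w\<close> whenever \<open>f < 1\<close> on a set of positive measure. The iterates of \<open>w\<close> decrease to a
  fixed point below \<open>1\<close>, which is \<open>q\<close>, and those of \<open>f\<close> are squeezed between them and \<open>T\<^sup>l(0)\<close>.
\<close>


subsection \<open>Lebesgue integration on the half-line\<close>

text \<open>Two points shape the proof. First, \<open>beta0\<close> is a \<open>GREATEST\<close>
  over the roots of a series and says nothing until a largest root is exhibited. In the variable s =
  1/\<beta> this is the least positive root of an entire function. Raising s from 0, where the
  series is 1, the value at x = 0 reaches zero while the whole function of x is still nonnegative.
  At that root the integral equation for the series turns into the eigenvalue equation of the kernel
  min(x,z) with eigenvalue 1/s. Second, \<phi>(x)/x decays like 1/x, so the nonlinear error in T w
  must be small relative to 1/x, uniformly in x. The yardstick is \<open>kern x 1\<close>, which is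
  min(1,1/x): since \<open>kern x z\<close> lies between \<open>kern x 1 * min 1 z\<close> and
  \<open>kern x 1 * (1 + z)\<close>, every comparison uniform in x reduces to one between two
  integrals over z. The error tends to zero by dominated convergence, without a rate; the factor 1/s
  > 1 gained by the linear part absorbs it.\<close>

abbreviation half_line :: "real measure" where
  "half_line \<equiv> lebesgue_on {0..}"

lemma sigma_finite_half_line: "sigma_finite_measure half_line"
proof -
  have "x \<in> (\<Union>n::nat. {- real n..real n})" for x
  proof -
    obtain n where "\<bar>x\<bar> \<le> real n" using real_arch_simple by blast
    then have "x \<in> {- real n..real n}" by auto
    then show ?thesis by blast
  qed
  then have "(\<Union>n::nat. {- real n..real n}) = UNIV" by auto
  moreover have "emeasure (lebesgue :: real measure) a \<noteq> \<infinity>" if "a \<in> range (\<lambda>n::nat. {- real n..real n})" for a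
  proof -
    from that obtain n :: nat where "a = {- real n..real n}" by blast
    then show ?thesis by (simp add: emeasure_lborel_Icc_eq)
  qed
  moreover have "range (\<lambda>n::nat. {- real n..real n}) \<subseteq> sets (lebesgue :: real measure)" by auto
  ultimately have "sigma_finite_measure (lebesgue :: real measure)"
    unfolding sigma_finite_measure_def
    by (intro exI[of _ "range (\<lambda>n::nat. {- real n..real n})"] conjI)
      (blast, blast, simp, blast)
  then show ?thesis
    by (rule sigma_finite_measure_restrict_space) simp
qed

interpretation half_line: sigma_finite_measure half_line
  by (rule sigma_finite_half_line)

interpretation half_plane: pair_sigma_finite half_line half_line ..

lemma borel_measurable_half_line:
  fixes g :: "real \<Rightarrow> real"
  shows "g \<in> borel_measurable borel \<Longrightarrow> g \<in> borel_measurable half_line"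
  by (rule measurable_restrict_space1) (simp add: measurable_completion)

lemma ident_half_line: "(\<lambda>x. x) \<in> half_line \<rightarrow>\<^sub>M borel"
  by (rule measurable_restrict_space1) (simp add: measurable_completion)

text \<open>The factors carry the Lebesgue sigma-algebra. Regarding the coordinates as Borel-valued
  maps makes conditions such as y \<le> z accessible to \<open>measurable\<close> in the Fubini
  arguments.\<close>

lemma fst_half_plane [measurable]:
  "fst \<in> half_line \<Otimes>\<^sub>M half_line \<rightarrow>\<^sub>M borel"
  using measurable_comp[OF measurable_fst ident_half_line] by (simp add: o_def)

lemma snd_half_plane [measurable]:
  "snd \<in> half_line \<Otimes>\<^sub>M half_line \<rightarrow>\<^sub>M borel"
  using measurable_comp[OF measurable_snd ident_half_line] by (simp add: o_def)

lemma set_lebesgue_integral_half_line: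
  fixes g :: "real \<Rightarrow> real"
  assumes "A \<in> sets borel" "A \<subseteq> {0..}"
  shows "(LINT z:A|lebesgue. g z) = (LINT z|half_line. indicator A z * g z)"
proof -
  have "indicator {0..} z *\<^sub>R (indicator A z * g z) = indicator A z *\<^sub>R g z" for z
    using assms(2) by (cases "z \<in> A") auto
  then show ?thesis
    unfolding set_lebesgue_integral_def by (subst integral_restrict_space) (simp, presburger)
qed

lemma AE_half_line_neq: "AE z in half_line. z \<noteq> (y::real)"
proof -
  have "AE z in lebesgue. z \<noteq> y"
    using AE_not_in[of "{y}" lebesgue] by simp
  then show ?thesis
    by (subst AE_restrict_space_iff) (auto elim: eventually_mono)
qed

lemma AE_half_line_cong: "(\<And>z. z \<ge> 0 \<Longrightarrow> Q z) \<Longrightarrow> AE z in half_line. Q z"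
  by (rule AE_I2) simp

text \<open>Tonelli: for fixed z, the points y of A with y \<le> z form
  \<open>A \<inter> {0..z}\<close>. The choice \<open>A = {0..x}\<close> produces the kernel
  min(x,z) of the operator, and \<open>A = {x..}\<close> the kernel max(0,z-x) of the recursion for
  \<open>G\<close>.\<close>

lemma half_line_iterated_integral:
  fixes w :: "real \<Rightarrow> real"
  assumes A: "A \<in> sets borel" "A \<subseteq> {0..}"
    and w [measurable]: "w \<in> borel_measurable half_line" and w0: "\<And>z. z \<ge> 0 \<Longrightarrow> 0 \<le> w z"
    and zw: "integrable half_line (\<lambda>z. z * w z)"
    and iw: "integrable half_line w"
  shows "has_bochner_integral half_line
      (\<lambda>y. indicator A y * (LINT z|half_line. indicator {y..} z * w z))
      (LINT z|half_line. measure lborel (A \<inter> {0..z}) * w z)"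
proof -
  have [measurable]: "A \<in> sets borel" by fact
  have [measurable]: "A \<in> sets half_line"
    using A by (subst sets_restrict_space_iff) auto
  have m0: "measure lborel (A \<inter> {0..z}) \<le> z" if "z \<ge> 0" for z
    using measure_mono_fmeasurable[of "A \<inter> {0..z}" "{0..z}" lborel] that
    by (auto simp: fmeasurable_def)
  have fin: "emeasure lborel (A \<inter> {0..z}) = ennreal (measure lborel (A \<inter> {0..z}))" for z
    using emeasure_mono[of "A \<inter> {0..z}" "{0..z}" lborel]
    by (intro emeasure_eq_ennreal_measure)
      (auto simp: emeasure_lborel_Icc_eq top_unique split: if_splits)
  have meas_slice: "(\<integral>\<^sup>+ y. indicator A y * indicator {y..} z \<partial>half_line)
      = emeasure lborel (A \<inter> {0..z})" for z
  proof -
    have "(\<integral>\<^sup>+ y. indicator A y * indicator {y..} z \<partial>half_line)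
        = (\<integral>\<^sup>+ y. indicator (A \<inter> {0..z}) y \<partial>lebesgue)"
    proof (subst nn_integral_restrict_space, simp, rule nn_integral_cong)
      fix y :: real
      show "indicator A y * indicator {y..} z * indicator {0..} y
          = (indicator (A \<inter> {0..z}) y :: ennreal)"
        using A(2) by (cases "y \<in> A"; cases "y \<le> z") auto
    qed
    also have "\<dots> = emeasure lebesgue (A \<inter> {0..z})"
      by (rule nn_integral_indicator) simp
    finally show ?thesis by simp
  qed
  have meas: "(\<lambda>z. measure lborel (A \<inter> {0..z})) \<in> borel_measurable half_line"
  proof (rule borel_measurable_half_line, rule borel_measurable_mono)
    show "mono (\<lambda>z. measure lborel (A \<inter> {0..z}))"
    proof (rule monoI)
      fix x z :: real assume "x \<le> z"
      then show "measure lborel (A \<inter> {0..x}) \<le> measure lborel (A \<inter> {0..z})"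
      proof (intro measure_mono_fmeasurable)
        show "A \<inter> {0..z} \<in> fmeasurable lborel"
          by (rule fmeasurableI2[of "{0..z}"]) (auto simp: fmeasurable_def emeasure_lborel_Icc_eq)
      qed auto
    qed
  qed
  have int: "integrable half_line (\<lambda>z. measure lborel (A \<inter> {0..z}) * w z)"
  proof (rule Bochner_Integration.integrable_bound[OF zw])
    show "(\<lambda>z. measure lborel (A \<inter> {0..z}) * w z) \<in> borel_measurable half_line"
      using meas w by (rule borel_measurable_times)
    have "\<bar>measure lborel (A \<inter> {0..z}) * w z\<bar> \<le> \<bar>z * w z\<bar>" if "z \<ge> 0" for z
      using m0[OF that] w0[OF that] that by (simp add: mult_right_mono)
    then show "AE z in half_line. norm (measure lborel (A \<inter> {0..z}) * w z) \<le> norm (z * w z)"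
      by (intro AE_half_line_cong) simp
  qed
  have inner: "ennreal (indicator A y * (LINT z|half_line. indicator {y..} z * w z))
      = (\<integral>\<^sup>+ z. indicator A y * indicator {y..} z * ennreal (w z) \<partial>half_line)" for y
  proof -
    have iy: "integrable half_line (\<lambda>z. indicator {y..} z * w z)"
    proof (rule Bochner_Integration.integrable_bound[OF iw])
      show "(\<lambda>z. indicator {y..} z * w z) \<in> borel_measurable half_line"
        by (intro borel_measurable_times w) (auto intro!: borel_measurable_half_line)
      show "AE z in half_line. norm (indicator {y..} z * w z) \<le> norm (w z)"
        by (rule AE_half_line_cong) (simp add: indicator_def)
    qed
    have "ennreal (LINT z|half_line. indicator {y..} z * w z)
        = (\<integral>\<^sup>+ z. ennreal (indicator {y..} z * w z) \<partial>half_line)"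
      by (rule nn_integral_eq_integral[symmetric, OF iy]) (auto intro!: AE_half_line_cong simp: w0)
    then show ?thesis
      by (cases "y \<in> A") (simp_all add: indicator_mult_ennreal ennreal_mult'' )
  qed
  show ?thesis
  proof (rule has_bochner_integral_nn_integral)
    show "(\<lambda>y. indicator A y * (LINT z|half_line. indicator {y..} z * w z)) \<in> borel_measurable half_line"
    proof -
      have "(\<lambda>(y, z). indicator {y..} z * w z) \<in> borel_measurable (half_line \<Otimes>\<^sub>M half_line)"
        unfolding indicator_def of_bool_def atLeast_iff by measurable
      from half_line.borel_measurable_lebesgue_integral[OF this]
      show ?thesis by measurable
    qed
    show "AE y in half_line. 0 \<le> indicator A y * (LINT z|half_line. indicator {y..} z * w z)"
      by (intro AE_half_line_cong mult_nonneg_nonneg Bochner_Integration.integral_nonneg_AE) (auto simp: w0)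
    show "0 \<le> (LINT z|half_line. measure lborel (A \<inter> {0..z}) * w z)"
      by (intro Bochner_Integration.integral_nonneg_AE AE_half_line_cong mult_nonneg_nonneg) (auto simp: w0)
    have "(\<integral>\<^sup>+ y. ennreal (indicator A y * (LINT z|half_line. indicator {y..} z * w z)) \<partial>half_line)
        = (\<integral>\<^sup>+ y. (\<integral>\<^sup>+ z. indicator A y * indicator {y..} z * ennreal (w z) \<partial>half_line) \<partial>half_line)"
      by (simp only: inner)
    also have "\<dots> = (\<integral>\<^sup>+ z. (\<integral>\<^sup>+ y. indicator A y * indicator {y..} z * ennreal (w z) \<partial>half_line) \<partial>half_line)"
      by (rule half_plane.Fubini'[symmetric])
        (unfold indicator_def of_bool_def atLeast_iff, measurable)
    also have "\<dots> = (\<integral>\<^sup>+ z. emeasure lborel (A \<inter> {0..z}) * ennreal (w z) \<partial>half_line)"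
    proof (intro nn_integral_cong)
      fix z :: real
      have "(\<lambda>y. indicator A y * indicator {y..} z :: ennreal) \<in> borel_measurable half_line"
        using ident_half_line unfolding indicator_def of_bool_def atLeast_iff by measurable
      then show "(\<integral>\<^sup>+ y. indicator A y * indicator {y..} z * ennreal (w z) \<partial>half_line)
          = emeasure lborel (A \<inter> {0..z}) * ennreal (w z)"
        by (simp add: nn_integral_multc meas_slice)
    qed
    also have "\<dots> = (\<integral>\<^sup>+ z. ennreal (measure lborel (A \<inter> {0..z}) * w z) \<partial>half_line)"
      by (intro nn_integral_cong) (simp add: fin ennreal_mult w0)
    also have "\<dots> = ennreal (LINT z|half_line. measure lborel (A \<inter> {0..z}) * w z)"
      by (rule nn_integral_eq_integral[OF int]) (auto intro!: AE_half_line_cong simp: w0)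
    finally show "(\<integral>\<^sup>+ y. ennreal (indicator A y * (LINT z|half_line. indicator {y..} z * w z)) \<partial>half_line)
      = ennreal (LINT z|half_line. measure lborel (A \<inter> {0..z}) * w z)" .
  qed
qed


text \<open>The value is the reciprocal of the normalizing constant of the Erlang density, whose
  total mass is 1.\<close>

lemma half_line_gamma_integral:
  assumes "c > 0"
  shows "has_bochner_integral half_line (\<lambda>z. z ^ k * exp (- (c * z))) (fact k / c ^ Suc k)"
proof -
  interpret prob_space "density lborel (erlang_density k c)"
    by (rule prob_space_erlang_density) fact
  have "(\<integral>\<^sup>+ z. ennreal (erlang_density k c z) \<partial>lborel) = 1"
    using emeasure_space_1 by (simp add: emeasure_density)
  then have "(\<integral>\<^sup>+ z. ennreal (erlang_density k c z) \<partial>lebesgue) = 1"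
    by (simp add: nn_integral_completion)
  moreover have "ennreal (erlang_density k c z) = ennreal (erlang_density k c z) * indicator {0..} z" for z
    by (auto simp: erlang_density_def indicator_def)
  ultimately have "(\<integral>\<^sup>+ z. ennreal (erlang_density k c z) \<partial>half_line) = ennreal 1"
    by (simp add: nn_integral_restrict_space)
  then have "has_bochner_integral half_line (erlang_density k c) 1"
    using assms by (intro has_bochner_integral_nn_integral borel_measurable_half_line) auto
  then have "has_bochner_integral half_line (\<lambda>z. fact k / c ^ Suc k * erlang_density k c z)
      (fact k / c ^ Suc k * 1)"
    by (rule has_bochner_integral_mult_right)
  moreover have "AE z in half_line. fact k / c ^ Suc k * erlang_density k c z = z ^ k * exp (- (c * z))"
    using assms by (intro AE_half_line_cong) (auto simp: erlang_density_def)
  ultimately show ?thesis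
    using has_bochner_integral_cong_AE[of "\<lambda>z. fact k / c ^ Suc k * erlang_density k c z" half_line
      "\<lambda>z. z ^ k * exp (- (c * z))"]
    by (simp add: borel_measurable_half_line)
qed

lemma integrable_power_exp_half_line:
  "c > 0 \<Longrightarrow> integrable half_line (\<lambda>z. z ^ k * exp (- (c * z)))"
  using half_line_gamma_integral[of c k] by (simp add: has_bochner_integral_iff)

lemma integrable_gamma_dens: "integrable half_line (gamma_dens k)"
  and integral_gamma_dens: "integral\<^sup>L half_line (gamma_dens k) = 1"
proof -
  have "has_bochner_integral half_line (\<lambda>z. (1 / fact k) * (z ^ k * exp (- (1 * z))))
      ((1 / fact k) * (fact k / 1 ^ Suc k))"
    by (intro has_bochner_integral_mult_right half_line_gamma_integral) simp
  also have "(\<lambda>z. (1 / fact k) * (z ^ k * exp (- (1 * z)))) = gamma_dens k"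
    by (auto simp: gamma_dens_def)
  finally have "has_bochner_integral half_line (gamma_dens k) 1" by simp
  then show "integrable half_line (gamma_dens k)" "integral\<^sup>L half_line (gamma_dens k) = 1"
    by (simp_all add: has_bochner_integral_iff)
qed

lemma gamma_dens_nonneg: "z \<ge> 0 \<Longrightarrow> 0 \<le> gamma_dens k z"
  by (simp add: gamma_dens_def)

lemma gamma_dens_pos: "z > 0 \<Longrightarrow> 0 < gamma_dens k z"
  by (simp add: gamma_dens_def)

text \<open>This index shift is what turns the factor k, which arises by differentiating a^k at a =
  1, into z \<open>g2\<close>.\<close>

lemma gamma_dens_Suc: "real (Suc k) * gamma_dens (Suc k) z = z * gamma_dens k z"
  unfolding gamma_dens_def fact_Suc by (simp add: field_simps del: of_nat_Suc)

lemma gamma_dens_measurable [measurable]: "gamma_dens k \<in> borel_measurable borel"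
  unfolding gamma_dens_def by measurable

lemma iterated_integral_tail:
  fixes w :: "real \<Rightarrow> real"
  assumes "x \<ge> 0" "w \<in> borel_measurable half_line" "\<And>z. z \<ge> 0 \<Longrightarrow> 0 \<le> w z"
    "integrable half_line (\<lambda>z. z * w z)" "integrable half_line w"
  shows "(LINT y:{x..}|lebesgue. (LINT z:{y..}|lebesgue. w z))
    = (LINT z|half_line. max 0 (z - x) * w z)"
proof -
  have "(LINT y:{x..}|lebesgue. (LINT z:{y..}|lebesgue. w z))
      = (LINT y|half_line. indicator {x..} y * (LINT z:{y..}|lebesgue. w z))"
    using assms(1) by (intro set_lebesgue_integral_half_line) auto
  also have "\<dots> = (LINT y|half_line. indicator {x..} y * (LINT z|half_line. indicator {y..} z * w z))"
    by (intro Bochner_Integration.integral_cong refl) (simp add: set_lebesgue_integral_half_line)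
  also have "\<dots> = (LINT z|half_line. measure lborel ({x..} \<inter> {0..z}) * w z)"
    using assms by (intro has_bochner_integral_integral_eq half_line_iterated_integral) auto
  also have "{x..} \<inter> {0..z} = {x..z}" for z using assms(1) by auto
  then have "(LINT z|half_line. measure lborel ({x..} \<inter> {0..z}) * w z) =
      (LINT z|half_line. max 0 (z - x) * w z)"
    by (intro Bochner_Integration.integral_cong refl) (auto simp: max_def)
  finally show ?thesis .
qed

lemma iterated_integral_initial:
  fixes w :: "real \<Rightarrow> real"
  assumes "x \<ge> 0" "w \<in> borel_measurable half_line" "\<And>z. z \<ge> 0 \<Longrightarrow> 0 \<le> w z"
    "integrable half_line (\<lambda>z. z * w z)" "integrable half_line w"
  shows "has_bochner_integral half_line
      (\<lambda>y. indicator {0..x} y * (LINT z|half_line. indicator {y..} z * w z))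
      (LINT z|half_line. min x z * w z)"
proof -
  have "measure lborel ({0..x} \<inter> {0..z}) = min x z" if "z \<ge> 0" for z
    using assms(1) that by (auto simp: min_def)
  then have "(LINT z|half_line. measure lborel ({0..x} \<inter> {0..z}) * w z) =
      (LINT z|half_line. min x z * w z)"
    by (intro Bochner_Integration.integral_cong refl) auto
  with half_line_iterated_integral[of "{0..x}" w] assms show ?thesis by auto
qed


subsection \<open>The offspring distribution\<close>

text \<open>Geometric decay of the coefficients becomes exponential decay in z, because the series
  with coefficients C r^k sums to C exp(-z) exp(r z).\<close>

lemma gamma_series:
  fixes a :: "nat \<Rightarrow> real"
  assumes "\<And>k. 0 \<le> a k" "\<And>k. a k \<le> C * r ^ k" "z \<ge> 0"
  shows "summable (\<lambda>k. a k * gamma_dens k z)"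
    and "(\<Sum>k. a k * gamma_dens k z) \<le> C * exp (- ((1 - r) * z))"
proof -
  have "(\<lambda>k. (r * z) ^ k /\<^sub>R fact k) sums exp (r * z)" by (rule exp_converges)
  then have "(\<lambda>k. (C * exp (- z)) * ((r * z) ^ k /\<^sub>R fact k)) sums (C * exp (- z) * exp (r * z))"
    by (rule sums_mult)
  also have "C * exp (- z) * exp (r * z) = C * exp (- ((1 - r) * z))"
    by (simp add: algebra_simps flip: exp_add)
  finally have s: "(\<lambda>k. (C * exp (- z)) * ((r * z) ^ k /\<^sub>R fact k)) sums (C * exp (- ((1 - r) * z)))" .
  have le: "a k * gamma_dens k z \<le> (C * exp (- z)) * ((r * z) ^ k /\<^sub>R fact k)" for k
    using mult_right_mono[OF assms(2)[of k] gamma_dens_nonneg[OF assms(3), of k]]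
    by (simp add: gamma_dens_def power_mult_distrib divide_inverse mult_ac)
  show *: "summable (\<lambda>k. a k * gamma_dens k z)"
    by (rule summable_comparison_test[OF _ sums_summable[OF s]])
      (use le assms gamma_dens_nonneg[OF assms(3)] in \<open>simp add: abs_mult\<close>)
  show "(\<Sum>k. a k * gamma_dens k z) \<le> C * exp (- ((1 - r) * z))"
    using suminf_le[OF le * sums_summable[OF s]] sums_unique[OF s] by simp
qed

lemma one_minus_power_nonneg: "0 \<le> a \<Longrightarrow> a \<le> 1 \<Longrightarrow> 0 \<le> 1 - (a::real) ^ k"
  by (simp add: power_le_one)

text \<open>This is \<open>min(x,z)/x\<close>, extended by its limit \<open>1\<close> to \<open>x = 0\<close>; it thus covers both
  cases in the definition of the operator.\<close>

definition kern :: "real \<Rightarrow> real \<Rightarrow> real" where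
  "kern x z = (if x \<le> z then 1 else z / x)"

lemma kern_nonneg: "0 \<le> x \<Longrightarrow> 0 \<le> z \<Longrightarrow> 0 \<le> kern x z"
  by (simp add: kern_def)

lemma kern_le_1: "0 \<le> x \<Longrightarrow> 0 \<le> z \<Longrightarrow> kern x z \<le> 1"
  by (simp add: kern_def divide_le_eq)

lemma kern_mult: "0 \<le> x \<Longrightarrow> 0 \<le> z \<Longrightarrow> x * kern x z = min x z"
  by (simp add: kern_def min_def)

lemma kern_measurable [measurable]: "kern x \<in> borel_measurable borel"
  unfolding kern_def by measurable

locale offspring =
  fixes P :: "nat pmf"
  assumes P0: "0 \<notin> set_pmf P"
    and P1: "pmf P 1 < 1"
    and P_exp: "\<exists>\<theta>>0. integrable (measure_pmf P) (\<lambda>n. exp (\<theta> * real n))"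
begin

definition p :: "nat \<Rightarrow> real" where
  "p k = pmf P (Suc k)"

lemma p_nonneg: "0 \<le> p k"
  by (simp add: p_def)

lemma p_sums: "p sums 1"
proof -
  have "(\<lambda>k. measure_pmf.prob P {Suc k}) sums measure_pmf.prob P (\<Union>k. {Suc k})"
    by (rule measure_pmf.finite_measure_UNION) (auto simp: disjoint_family_on_def)
  moreover have "measure_pmf.prob P (\<Union>k. {Suc k}) = 1"
  proof (subst measure_pmf.prob_eq_1)
    have "n \<in> (\<Union>k. {Suc k})" if "n \<in> set_pmf P" for n
      using P0 that by (cases n) auto
    then show "AE n in measure_pmf P. n \<in> (\<Union>k. {Suc k})"
      by (simp add: AE_measure_pmf_iff)
  qed simp
  moreover have "(\<lambda>k. measure_pmf.prob P {Suc k}) = p"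
    by (simp add: fun_eq_iff p_def measure_pmf_single)
  ultimately show ?thesis by simp
qed

text \<open>Markov's inequality for the exponential moment, with r = exp(-\<theta>). Adding 1 to the
  expectation makes the constant visibly positive.\<close>

lemma pmf_geometric_bound:
  obtains C r where "C > 0" "0 < r" "r < 1" "\<And>n. pmf P n \<le> C * r ^ n"
proof -
  obtain \<theta> where \<theta>: "\<theta> > 0" "integrable (measure_pmf P) (\<lambda>n. exp (\<theta> * real n))"
    using P_exp by blast
  let ?E = "measure_pmf.expectation P (\<lambda>n. exp (\<theta> * real n))"
  have le: "pmf P n * exp (\<theta> * real n) \<le> ?E" for n
  proof -
    have "measure_pmf.expectation P (\<lambda>m. exp (\<theta> * real n) * indicator {n} m) \<le> ?E"
    proof (rule integral_mono)
      show "integrable (measure_pmf P) (\<lambda>m. exp (\<theta> * real n) * indicator {n} m)"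
        by (intro integrable_mult_right integrable_real_indicator)
          (auto simp: less_top[symmetric] measure_pmf.emeasure_finite)
    qed (use \<theta>(2) in \<open>auto simp: indicator_def\<close>)
    then show ?thesis by (simp add: measure_pmf_single mult.commute)
  qed
  have "pmf P n \<le> (?E + 1) * exp (- \<theta>) ^ n" for n
  proof -
    have "pmf P n = (pmf P n * exp (\<theta> * real n)) * exp (- \<theta>) ^ n"
      by (simp add: exp_minus power_inverse mult.commute flip: exp_of_nat_mult)
    also have "\<dots> \<le> (?E + 1) * exp (- \<theta>) ^ n"
      by (intro mult_right_mono) (use le[of n] in auto)
    finally show ?thesis .
  qed
  moreover have "0 \<le> ?E" by (rule Bochner_Integration.integral_nonneg) simp
  then have "0 < ?E + 1" by linarith
  ultimately show ?thesis using that[of "?E + 1" "exp (- \<theta>)"] \<theta>(1) by auto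
qed

text \<open>The exponential moment enters the remaining proof only through these facts. The decay
  rate is c = 1 - r, with r the ratio of the geometric bound.\<close>

lemma g2_eq: "g2 P z = (\<Sum>k. p (Suc k) * gamma_dens k z)"
  and g2_summable: "z \<ge> 0 \<Longrightarrow> summable (\<lambda>k. p (Suc k) * gamma_dens k z)"
  and p_gamma_summable: "z \<ge> 0 \<Longrightarrow> summable (\<lambda>k. p k * gamma_dens k z)"
  and exponential_bounds: "\<exists>C c. C > 0 \<and> c > 0 \<and> (\<forall>z\<ge>0. g2 P z \<le> C * exp (- (c * z)) \<and>
    (\<Sum>k. p k * gamma_dens k z) \<le> C * exp (- (c * z)))"
proof -
  obtain C r where Cr: "C > 0" "0 < r" "r < 1" "\<And>n. pmf P n \<le> C * r ^ n"
    using pmf_geometric_bound by blast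
  have p: "p k \<le> C * r ^ k" for k
  proof -
    have "p k \<le> C * r ^ Suc k" unfolding p_def by (rule Cr)
    also have "\<dots> \<le> C * r ^ k" using Cr by (intro mult_left_mono power_decreasing) auto
    finally show ?thesis .
  qed
  have p': "p (Suc k) \<le> C * r ^ k" for k
  proof -
    have "p (Suc k) \<le> C * r ^ Suc k" by (rule p)
    also have "\<dots> \<le> C * r ^ k" using Cr by (intro mult_left_mono power_decreasing) auto
    finally show ?thesis .
  qed
  show s1: "summable (\<lambda>k. p k * gamma_dens k z)" if "z \<ge> 0" for z
    using gamma_series(1)[OF p_nonneg p that] .
  show s2: "summable (\<lambda>k. p (Suc k) * gamma_dens k z)" if "z \<ge> 0" for z
    using gamma_series(1)[OF p_nonneg p' that] .
  have eq: "p (Suc k) * gamma_dens k z = exp (- z) * (pmf P (k + 2) * z ^ k / fact k)" for k z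
    by (simp add: p_def gamma_dens_def)
  show g2: "g2 P z = (\<Sum>k. p (Suc k) * gamma_dens k z)" for z
  proof -
    have "(\<Sum>k. p (Suc k) * gamma_dens k z) = (\<Sum>k. exp (- z) * (pmf P (k + 2) * z ^ k / fact k))"
      by (simp only: eq)
    also have "\<dots> = g2 P z" unfolding g2_def
    proof (rule suminf_mult)
      \<comment> \<open>\<open>g2_eq\<close> is claimed for every real z, so convergence is checked
        with the absolute value and without using the sign of z.\<close>
      have "summable (\<lambda>k. C * (\<bar>z\<bar> ^ k / fact k))"
        using summable_exp_generic[of "\<bar>z\<bar>"] by (intro summable_mult) (simp add: divide_inverse mult.commute)
      moreover have "norm (pmf P (k + 2) * z ^ k / fact k) \<le> C * (\<bar>z\<bar> ^ k / fact k)" for k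
      proof -
        have "pmf P (k + 2) \<le> C" 
          using p'[of k] power_le_one[of r k] Cr by (smt (verit, best) add_2_eq_Suc' mult_left_le p_def)
        then have "pmf P (k + 2) * (\<bar>z\<bar> ^ k / fact k) \<le> C * (\<bar>z\<bar> ^ k / fact k)"
          by (intro mult_right_mono) auto
        then show ?thesis by (simp add: abs_mult power_abs)
      qed
      ultimately show "summable (\<lambda>k. pmf P (k + 2) * z ^ k / fact k)"
        by (intro summable_comparison_test[of "\<lambda>k. pmf P (k + 2) * z ^ k / fact k"]) auto
    qed
    finally show ?thesis by simp
  qed
  have "\<forall>z\<ge>0. g2 P z \<le> C * exp (- ((1 - r) * z)) \<and>
    (\<Sum>k. p k * gamma_dens k z) \<le> C * exp (- ((1 - r) * z))"
    using gamma_series(2)[OF p_nonneg p'] gamma_series(2)[OF p_nonneg p] by (simp add: g2)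
  then show "\<exists>C c. C > 0 \<and> c > 0 \<and> (\<forall>z\<ge>0. g2 P z \<le> C * exp (- (c * z)) \<and>
    (\<Sum>k. p k * gamma_dens k z) \<le> C * exp (- (c * z)))"
    using Cr by (intro exI[of _ C] exI[of _ "1 - r"]) auto
qed

section \<open>The nonlinearity and its quotient by 1 - a\<close>

definition D :: "real \<Rightarrow> real \<Rightarrow> real" where
  "D z a = (\<Sum>k. p k * gamma_dens k z * (1 - a ^ k))"

text \<open>The inner sum is (1 - a^k)/(1 - a) in polynomial form, so that \<open>S\<close> also
  makes sense at a = 1 and its monotonicity in a is visible termwise.\<close>

definition S :: "real \<Rightarrow> real \<Rightarrow> real" where
  "S z a = (\<Sum>k. p k * gamma_dens k z * (\<Sum>j<k. a ^ j))"

text \<open>Apply \<open>gamma_dens_Suc\<close> to each term with positive index; the term k = 0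
  vanishes. Besides evaluating \<open>S z 1\<close>, this series dominates \<open>S\<close> and
  supplies the Lipschitz constant of \<open>D\<close>.\<close>

lemma S_terms_sums: "z \<ge> 0 \<Longrightarrow> (\<lambda>k. p k * gamma_dens k z * real k) sums (z * g2 P z)"
proof -
  assume "z \<ge> 0"
  then have "(\<lambda>k. z * (p (Suc k) * gamma_dens k z)) sums (z * g2 P z)"
    unfolding g2_eq by (intro sums_mult summable_sums g2_summable)
  moreover have "z * (p (Suc k) * gamma_dens k z) = p (Suc k) * gamma_dens (Suc k) z * real (Suc k)" for k
    using gamma_dens_Suc[of k z] by (simp add: mult_ac)
  ultimately have "(\<lambda>k. p (Suc k) * gamma_dens (Suc k) z * real (Suc k)) sums (z * g2 P z)"
    by simp
  then show ?thesis by (subst (asm) sums_Suc_iff) simp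
qed

lemma D_summable:
  assumes "z \<ge> 0" "0 \<le> a" "a \<le> 1"
  shows "summable (\<lambda>k. p k * gamma_dens k z * (1 - a ^ k))"
  by (rule summable_comparison_test[OF _ p_gamma_summable[OF assms(1)]])
    (use assms p_nonneg gamma_dens_nonneg[OF assms(1)] one_minus_power_nonneg[of a] in
      \<open>auto simp: abs_mult intro!: mult_left_le mult_nonneg_nonneg\<close>)

lemma S_summable:
  assumes "z \<ge> 0" "0 \<le> a" "a \<le> 1"
  shows "summable (\<lambda>k. p k * gamma_dens k z * (\<Sum>j<k. a ^ j))"
proof (rule summable_comparison_test[OF _ sums_summable[OF S_terms_sums[OF assms(1)]]], intro exI allI impI)
  fix k
  have "(\<Sum>j<k. a ^ j) \<le> (\<Sum>j<k. 1)" using assms by (intro sum_mono power_le_one)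
  moreover have "0 \<le> (\<Sum>j<k. a ^ j)" using assms by (intro sum_nonneg) auto
  ultimately show "norm (p k * gamma_dens k z * (\<Sum>j<k. a ^ j)) \<le> p k * gamma_dens k z * real k"
    using p_nonneg[of k] gamma_dens_nonneg[OF assms(1), of k] by (simp add: abs_mult mult_left_mono)
qed

lemma S_1: "z \<ge> 0 \<Longrightarrow> S z 1 = z * g2 P z"
  using S_terms_sums[of z] unfolding S_def by (simp add: sums_iff)

lemma D_eq_S:
  assumes "z \<ge> 0" "0 \<le> a" "a \<le> 1"
  shows "D z a = (1 - a) * S z a"
  unfolding D_def S_def using S_summable[OF assms]
  by (simp add: one_diff_power_eq mult.left_commute flip: suminf_mult)

lemma D_nonneg: "z \<ge> 0 \<Longrightarrow> 0 \<le> a \<Longrightarrow> a \<le> 1 \<Longrightarrow> 0 \<le> D z a"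
  unfolding D_def using D_summable p_nonneg gamma_dens_nonneg one_minus_power_nonneg
  by (intro suminf_nonneg) auto

lemma D_antimono:
  "z \<ge> 0 \<Longrightarrow> 0 \<le> a \<Longrightarrow> a \<le> b \<Longrightarrow> b \<le> 1 \<Longrightarrow> D z b \<le> D z a"
  unfolding D_def using D_summable[of z a] D_summable[of z b]
  by (intro suminf_le mult_left_mono mult_nonneg_nonneg p_nonneg gamma_dens_nonneg)
    (auto intro: power_mono)

lemma S_nonneg: "z \<ge> 0 \<Longrightarrow> 0 \<le> a \<Longrightarrow> a \<le> 1 \<Longrightarrow> 0 \<le> S z a"
  unfolding S_def using S_summable p_nonneg gamma_dens_nonneg
  by (intro suminf_nonneg) (auto intro!: mult_nonneg_nonneg sum_nonneg)

lemma S_mono: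
  "z \<ge> 0 \<Longrightarrow> 0 \<le> a \<Longrightarrow> a \<le> b \<Longrightarrow> b \<le> 1 \<Longrightarrow> S z a \<le> S z b"
  unfolding S_def using S_summable[of z a] S_summable[of z b]
  by (intro suminf_le mult_left_mono mult_nonneg_nonneg p_nonneg gamma_dens_nonneg sum_mono)
    (auto intro: power_mono)

lemma D_le: "z \<ge> 0 \<Longrightarrow> 0 \<le> a \<Longrightarrow> a \<le> 1 \<Longrightarrow> D z a \<le> (\<Sum>k. p k * gamma_dens k z)"
  unfolding D_def using D_summable p_gamma_summable p_nonneg gamma_dens_nonneg
  by (intro suminf_le mult_left_le) (auto intro!: mult_nonneg_nonneg)

lemma D_measurable [measurable (raw)]:
  assumes [measurable]: "g \<in> borel_measurable M" "f \<in> borel_measurable M"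
  shows "(\<lambda>x. D (g x) (f x)) \<in> borel_measurable M"
  unfolding D_def by measurable

lemma S_measurable [measurable (raw)]:
  assumes [measurable]: "g \<in> borel_measurable M" "f \<in> borel_measurable M"
  shows "(\<lambda>x. S (g x) (f x)) \<in> borel_measurable M"
  unfolding S_def by measurable

lemma g2_measurable [measurable]: "g2 P \<in> borel_measurable borel"
  unfolding g2_def by measurable

lemma g2_nonneg: "z \<ge> 0 \<Longrightarrow> 0 \<le> g2 P z"
  unfolding g2_eq using g2_summable p_nonneg gamma_dens_nonneg by (intro suminf_nonneg) auto

end


subsection \<open>The operator as an integral operator\<close>

lemma integrable_half_line_bound:
  fixes f :: "real \<Rightarrow> real"
  assumes "integrable half_line g" "f \<in> borel_measurable half_line"
    and "\<And>z. z \<ge> 0 \<Longrightarrow> \<bar>f z\<bar> \<le> g z"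
  shows "integrable half_line f"
  using assms(1,2)
proof (rule Bochner_Integration.integrable_bound)
  show "AE z in half_line. norm (f z) \<le> norm (g z)"
    using assms(3) by (intro AE_half_line_cong) (metis abs_le_iff abs_of_nonneg abs_ge_zero order.trans real_norm_def)
qed

lemma half_line_integral_mono:
  fixes f g :: "real \<Rightarrow> real"
  assumes "integrable half_line f" "integrable half_line g" "\<And>z. z \<ge> 0 \<Longrightarrow> f z \<le> g z"
  shows "integral\<^sup>L half_line f \<le> integral\<^sup>L half_line g"
  by (rule integral_mono) (use assms in auto)

lemma half_line_integral_nonneg:
  fixes f :: "real \<Rightarrow> real"
  assumes "\<And>z. z \<ge> 0 \<Longrightarrow> 0 \<le> f z"
  shows "0 \<le> integral\<^sup>L half_line f"
  by (rule Bochner_Integration.integral_nonneg_AE) (rule AE_half_line_cong, rule assms)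

lemma half_line_integral_cong:
  fixes f g :: "real \<Rightarrow> real"
  assumes "\<And>z. z \<ge> 0 \<Longrightarrow> f z = g z"
  shows "integral\<^sup>L half_line f = integral\<^sup>L half_line g"
  by (rule Bochner_Integration.integral_cong) (use assms in auto)

lemma summable_nonneg_le:
  fixes a b :: "nat \<Rightarrow> real"
  assumes "summable b" "\<And>k. 0 \<le> a k" "\<And>k. a k \<le> b k"
  shows "summable a"
  using assms(1) by (rule summable_comparison_test'[of _ 0]) (use assms(2,3) in simp)

lemma gamma_dens_half_line: "gamma_dens k \<in> borel_measurable half_line"
  by (rule borel_measurable_half_line) (rule gamma_dens_measurable)

lemma integrable_mult_gamma_dens: "integrable half_line (\<lambda>z. z * gamma_dens k z)"
  by (simp add: gamma_dens_Suc[symmetric] integrable_gamma_dens)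

lemma kern_half_line: "kern x \<in> borel_measurable half_line"
  by (rule borel_measurable_half_line) (rule kern_measurable)

text \<open>The Gamma density has mass 1, so the left side is one minus the integral of the
  complement 1 - h over the tail beyond y.\<close>

lemma T_integrand:
  fixes h :: "real \<Rightarrow> real"
  assumes h: "h \<in> borel_measurable half_line" "\<And>z. z \<ge> 0 \<Longrightarrow> 0 \<le> h z" "\<And>z. z \<ge> 0 \<Longrightarrow> h z \<le> 1"
    and y: "y \<ge> 0"
  shows "(LINT z:{0..y}|lebesgue. gamma_dens k z) + (LINT z:{y..}|lebesgue. gamma_dens k z * h z)
    = 1 - (LINT z|half_line. indicator {y..} z * (gamma_dens k z * (1 - h z)))"
proof -
  have gi: "integrable half_line (\<lambda>z. u z * gamma_dens k z)"
    if "u \<in> borel_measurable half_line" "\<And>z. z \<ge> 0 \<Longrightarrow> \<bar>u z\<bar> \<le> 1" for u :: "real \<Rightarrow> real"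
    using that gamma_dens_nonneg
    by (intro integrable_half_line_bound[OF integrable_gamma_dens[of k]]
        borel_measurable_times gamma_dens_half_line) (auto simp: abs_mult intro: mult_left_le_one_le)
  have ind: "(indicator A :: real \<Rightarrow> real) \<in> borel_measurable half_line" if "A \<in> sets borel" for A :: "real set"
    using that by (intro borel_measurable_half_line) simp
  have i1: "integrable half_line (\<lambda>z. indicator {0..y} z * gamma_dens k z)"
    by (intro gi ind) (auto simp: indicator_def)
  have "integrable half_line (\<lambda>z. (indicator {y..} z * h z) * gamma_dens k z)"
    using h by (intro gi borel_measurable_times ind) (auto simp: indicator_def)
  then have i2: "integrable half_line (\<lambda>z. indicator {y..} z * (gamma_dens k z * h z))"
    by (simp add: mult_ac)
  have "integrable half_line (\<lambda>z. (indicator {y..} z * (1 - h z)) * gamma_dens k z)"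
    using h by (intro gi borel_measurable_times borel_measurable_diff ind) (auto simp: indicator_def)
  then have i3: "integrable half_line (\<lambda>z. indicator {y..} z * (gamma_dens k z * (1 - h z)))"
    by (simp add: mult_ac)
  have "(LINT z:{0..y}|lebesgue. gamma_dens k z) + (LINT z:{y..}|lebesgue. gamma_dens k z * h z)
    = (LINT z|half_line. indicator {0..y} z * gamma_dens k z)
      + (LINT z|half_line. indicator {y..} z * (gamma_dens k z * h z))"
    using y by (simp add: set_lebesgue_integral_half_line)
  also have "\<dots> = (LINT z|half_line. indicator {0..y} z * gamma_dens k z
      + indicator {y..} z * (gamma_dens k z * h z))"
    using i1 i2 by simp
  \<comment> \<open>The point z = y lies in both intervals, hence equality only almost
    everywhere.\<close>
  also have "\<dots> = (LINT z|half_line. gamma_dens k z - indicator {y..} z * (gamma_dens k z * (1 - h z)))"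
  proof (rule Bochner_Integration.integral_cong_AE)
    have "AE z in half_line. (0::real) \<le> z" by (rule AE_half_line_cong)
    with AE_half_line_neq[of y]
    show "AE z in half_line. indicator {0..y} z * gamma_dens k z + indicator {y..} z * (gamma_dens k z * h z)
      = gamma_dens k z - indicator {y..} z * (gamma_dens k z * (1 - h z))"
      by eventually_elim (auto simp: indicator_def algebra_simps)
  qed (rule borel_measurable_integrable[OF Bochner_Integration.integrable_add[OF i1 i2]]
      borel_measurable_integrable[OF Bochner_Integration.integrable_diff[OF integrable_gamma_dens i3]])+
  also have "\<dots> = 1 - (LINT z|half_line. indicator {y..} z * (gamma_dens k z * (1 - h z)))"
    using i3 by (simp add: integrable_gamma_dens integral_gamma_dens)
  finally show ?thesis .
qed

text \<open>Integrating the complement form over y in [0,x] gives the kernel min(x,z), which is x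
  \<open>kern x z\<close>. In \<open>T_eq\<close> the function h is the k-th power of f.\<close>

lemma T_component:
  fixes h :: "real \<Rightarrow> real"
  assumes h: "h \<in> borel_measurable half_line" "\<And>z. z \<ge> 0 \<Longrightarrow> 0 \<le> h z" "\<And>z. z \<ge> 0 \<Longrightarrow> h z \<le> 1"
    and x: "x \<ge> 0"
  shows "(LINT y:{0..x}|lebesgue. (LINT z:{0..y}|lebesgue. gamma_dens k z)
      + (LINT z:{y..}|lebesgue. gamma_dens k z * h z))
    = x * (1 - (LINT z|half_line. kern x z * (gamma_dens k z * (1 - h z))))"
proof -
  let ?w = "\<lambda>z. gamma_dens k z * (1 - h z)"
  have wm: "?w \<in> borel_measurable half_line"
    using h(1) by (intro borel_measurable_times borel_measurable_diff gamma_dens_half_line) auto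
  have w0: "0 \<le> ?w z" and wle: "?w z \<le> gamma_dens k z" if "z \<ge> 0" for z
    using that h gamma_dens_nonneg[of z k] by (auto intro!: mult_nonneg_nonneg mult_left_le)
  have iw: "integrable half_line ?w"
    using w0 wle by (intro integrable_half_line_bound[OF integrable_gamma_dens[of k] wm]) auto
  have izw: "integrable half_line (\<lambda>z. z * ?w z)"
  proof (rule integrable_half_line_bound[OF integrable_mult_gamma_dens[of k]])
    show "(\<lambda>z. z * ?w z) \<in> borel_measurable half_line"
      by (rule borel_measurable_times[OF ident_half_line wm])
    show "\<bar>z * ?w z\<bar> \<le> z * gamma_dens k z" if "z \<ge> 0" for z
      using mult_left_mono[OF wle[OF that] that]
      by (simp only: abs_of_nonneg[OF mult_nonneg_nonneg[OF that w0[OF that]]])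
  qed
  have "(LINT y:{0..x}|lebesgue. (LINT z:{0..y}|lebesgue. gamma_dens k z)
      + (LINT z:{y..}|lebesgue. gamma_dens k z * h z))
    = (LINT y|half_line. indicator {0..x} y - indicator {0..x} y * (LINT z|half_line. indicator {y..} z * ?w z))"
    by (subst set_lebesgue_integral_half_line)
      (auto intro!: half_line_integral_cong simp: T_integrand[OF h] right_diff_distrib)
  also have "\<dots> = x - (LINT z|half_line. min x z * ?w z)"
  proof (intro has_bochner_integral_integral_eq has_bochner_integral_diff)
    show "has_bochner_integral half_line
        (\<lambda>y. indicator {0..x} y * (LINT z|half_line. indicator {y..} z * ?w z))
        (LINT z|half_line. min x z * ?w z)"
      by (rule iterated_integral_initial[OF x wm w0 izw iw])
    have "{0..x} \<in> sets half_line" by (subst sets_restrict_space_iff) auto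
    moreover have "emeasure half_line {0..x} = ennreal x"
      using x by (subst emeasure_restrict_space) auto
    ultimately show "has_bochner_integral half_line (indicator {0..x}) x"
      using has_bochner_integral_real_indicator[of "{0..x}" half_line] x by (simp add: measure_def)
  qed
  also have "(LINT z|half_line. min x z * ?w z) = (LINT z|half_line. x * (kern x z * ?w z))"
    by (rule half_line_integral_cong) (simp only: mult.assoc[symmetric] kern_mult[OF x])
  also have "x - \<dots> = x * (1 - (LINT z|half_line. kern x z * ?w z))"
    by (simp only: integral_mult_right_zero right_diff_distrib[of x 1] mult_1_right)
  finally show ?thesis .
qed

lemma meas_funsD:
  assumes "f \<in> meas_funs"
  shows "f \<in> borel_measurable half_line" "z \<ge> 0 \<Longrightarrow> 0 \<le> f z" "z \<ge> 0 \<Longrightarrow> f z \<le> 1"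
    "f \<in> extensional {0..}"
  using assms by (auto simp: meas_funs_def PiE_def Pi_def)

context offspring
begin

lemma D_half_line:
  "f \<in> borel_measurable half_line \<Longrightarrow> (\<lambda>z. D z (f z)) \<in> borel_measurable half_line"
  by (rule D_measurable) (rule ident_half_line)

lemma S_half_line:
  "f \<in> borel_measurable half_line \<Longrightarrow> (\<lambda>z. S z (f z)) \<in> borel_measurable half_line"
  by (rule S_measurable) (rule ident_half_line)

lemma g2_half_line: "g2 P \<in> borel_measurable half_line"
  by (rule borel_measurable_half_line) (rule g2_measurable)

lemma integrable_power_g2: "integrable half_line (\<lambda>z. z ^ n * g2 P z)"
proof -
  obtain C c where C: "C > 0" "c > 0" "\<And>z. z \<ge> 0 \<Longrightarrow> g2 P z \<le> C * exp (- (c * z))"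
    using exponential_bounds by blast
  show ?thesis
  proof (rule integrable_half_line_bound)
    show "integrable half_line (\<lambda>z. C * (z ^ n * exp (- (c * z))))"
      by (rule integrable_mult_right[OF integrable_power_exp_half_line[OF C(2)]])
    show "(\<lambda>z. z ^ n * g2 P z) \<in> borel_measurable half_line"
      by (rule borel_measurable_times[OF borel_measurable_power[OF ident_half_line] g2_half_line])
    show "\<bar>z ^ n * g2 P z\<bar> \<le> C * (z ^ n * exp (- (c * z)))" if "z \<ge> 0" for z
      using mult_left_mono[OF C(3)[OF that], of "z ^ n"] that g2_nonneg[OF that]
      by (simp add: abs_mult mult_ac)
  qed
qed

lemma integrable_power_D0: "integrable half_line (\<lambda>z. z ^ n * D z 0)"
proof -
  obtain C c where C: "C > 0" "c > 0" "\<And>z. z \<ge> 0 \<Longrightarrow> (\<Sum>k. p k * gamma_dens k z) \<le> C * exp (- (c * z))"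
    using exponential_bounds by blast
  show ?thesis
  proof (rule integrable_half_line_bound)
    show "integrable half_line (\<lambda>z. C * (z ^ n * exp (- (c * z))))"
      by (rule integrable_mult_right[OF integrable_power_exp_half_line[OF C(2)]])
    show "(\<lambda>z. z ^ n * D z 0) \<in> borel_measurable half_line"
      by (rule borel_measurable_times[OF borel_measurable_power[OF ident_half_line] D_half_line[OF borel_measurable_const]])
    show "\<bar>z ^ n * D z 0\<bar> \<le> C * (z ^ n * exp (- (c * z)))" if "z \<ge> 0" for z
      using mult_left_mono[OF order.trans[OF D_le C(3)], of z 0 "z ^ n"] that D_nonneg[of z 0]
      by (simp add: abs_mult mult_ac)
  qed
qed

text \<open>The working form of the operator: the two branches of \<open>T_op\<close> agree since
  \<open>kern 0 z\<close> is 1, and the sum over k may be taken inside the integral.\<close>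

lemma T_eq:
  assumes f: "f \<in> meas_funs" and x: "x \<ge> 0"
  shows "T_op P f x = 1 - (LINT z|half_line. kern x z * D z (f z))"
proof -
  note fm = meas_funsD[OF f]
  let ?u = "\<lambda>k z. kern x z * (gamma_dens k z * (1 - f z ^ k))"
  have um: "?u k \<in> borel_measurable half_line" for k
    using fm(1) by (intro borel_measurable_times borel_measurable_diff kern_half_line gamma_dens_half_line) auto
  have u0: "0 \<le> ?u k z" if "z \<ge> 0" for k z
    using that fm x by (intro mult_nonneg_nonneg kern_nonneg gamma_dens_nonneg one_minus_power_nonneg)
  have ule: "?u k z \<le> gamma_dens k z" if "z \<ge> 0" for k z
  proof -
    have "gamma_dens k z * (1 - f z ^ k) \<le> gamma_dens k z"
      using that fm gamma_dens_nonneg by (intro mult_left_le) auto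
    moreover have "0 \<le> gamma_dens k z * (1 - f z ^ k)"
      using that fm by (intro mult_nonneg_nonneg gamma_dens_nonneg one_minus_power_nonneg)
    ultimately show ?thesis
      using kern_nonneg[OF x that] kern_le_1[OF x that] by (meson mult_left_le_one_le order.trans)
  qed
  have iu: "integrable half_line (?u k)" for k
    using u0 ule by (intro integrable_half_line_bound[OF integrable_gamma_dens[of k] um]) auto
  \<comment> \<open>An expectation of kern(x,Z)(1 - f(Z)^k) for a Gamma variable Z of shape k + 1,
    hence a number in [0,1]; this makes all the series below converge.\<close>
  let ?e = "\<lambda>k. integral\<^sup>L half_line (?u k)"
  have e0: "0 \<le> ?e k" for k by (rule half_line_integral_nonneg) (rule u0)
  have e1: "?e k \<le> 1" for k
    using half_line_integral_mono[OF iu integrable_gamma_dens ule, of k] by (simp add: integral_gamma_dens)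
  have pe: "summable (\<lambda>k. p k * ?e k)"
    using sums_summable[OF p_sums]
    by (rule summable_nonneg_le) (rule mult_nonneg_nonneg[OF p_nonneg e0] mult_left_le[OF e1 p_nonneg])+
  have "T_op P f x = (\<Sum>k. p k * (1 - ?e k))"
  proof (cases "x = 0")
    case True
    have "(LINT z:{0..}|lebesgue. gamma_dens k z * f z ^ k) = 1 - ?e k" for k
    proof -
      have "(LINT z:{0..}|lebesgue. gamma_dens k z * f z ^ k)
          = (LINT z|half_line. indicator {0..} z * (gamma_dens k z * f z ^ k))"
        by (rule set_lebesgue_integral_half_line) auto
      also have "\<dots> = (LINT z|half_line. gamma_dens k z - ?u k z)"
        by (rule half_line_integral_cong) (simp add: True kern_def algebra_simps)
      also have "\<dots> = 1 - ?e k"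
        by (simp only: Bochner_Integration.integral_diff[OF integrable_gamma_dens iu] integral_gamma_dens)
      finally show ?thesis .
    qed
    then show ?thesis using True by (simp add: T_op_def p_def)
  next
    case False
    have m: "(\<lambda>z. f z ^ k) \<in> borel_measurable half_line" for k
      using fm(1) by (rule borel_measurable_power)
    have "(LINT y:{0..x}|lebesgue. (LINT z:{0..y}|lebesgue. gamma_dens k z)
      + (LINT z:{y..}|lebesgue. gamma_dens k z * f z ^ k)) = x * (1 - ?e k)" for k
      using fm(2,3) by (intro T_component[OF m _ _ x]) (auto intro: power_le_one)
    then have "T_op P f x = 1 / x * (\<Sum>k. x * (p k * (1 - ?e k)))"
      using x False by (simp add: T_op_def p_def mult_ac)
    also have "(\<Sum>k. x * (p k * (1 - ?e k))) = x * (\<Sum>k. p k * (1 - ?e k))"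
      using pe sums_summable[OF p_sums] by (intro suminf_mult) (simp add: right_diff_distrib summable_diff)
    finally show ?thesis using False by simp
  qed
  also have "\<dots> = (\<Sum>k. p k) - (\<Sum>k. p k * ?e k)"
    using pe sums_summable[OF p_sums] by (simp add: right_diff_distrib suminf_diff)
  also have "(\<Sum>k. p k * ?e k) = (\<Sum>k. integral\<^sup>L half_line (\<lambda>z. p k * ?u k z))"
    by simp
  also have "\<dots> = (LINT z|half_line. (\<Sum>k. p k * ?u k z))"
  proof (rule integral_suminf[symmetric])
    show "integrable half_line (\<lambda>z. p k * ?u k z)" for k
      using iu by (rule integrable_mult_right)
    show "AE z in half_line. summable (\<lambda>k. norm (p k * ?u k z))"
    proof (rule AE_half_line_cong)
      fix z :: real assume z: "z \<ge> 0"
      show "summable (\<lambda>k. norm (p k * ?u k z))"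
        using p_gamma_summable[OF z]
      proof (rule summable_nonneg_le)
        show "norm (p k * ?u k z) \<le> p k * gamma_dens k z" for k
          using mult_left_mono[OF ule[OF z] p_nonneg, of k]
          by (simp only: real_norm_def abs_of_nonneg[OF mult_nonneg_nonneg[OF p_nonneg u0[OF z]]])
      qed simp
    qed
    have "(LINT z|half_line. norm (p k * ?u k z)) = p k * ?e k" for k
    proof -
      have "(LINT z|half_line. norm (p k * ?u k z)) = (LINT z|half_line. p k * ?u k z)"
        by (intro half_line_integral_cong)
          (simp only: real_norm_def abs_of_nonneg[OF mult_nonneg_nonneg[OF p_nonneg u0]])
      then show ?thesis by simp
    qed
    then show "summable (\<lambda>k. LINT z|half_line. norm (p k * ?u k z))"
      using pe by simp
  qed
  also have "\<dots> = (LINT z|half_line. kern x z * D z (f z))"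
  proof (rule half_line_integral_cong)
    fix z :: real assume z: "z \<ge> 0"
    have "kern x z * D z (f z) = (\<Sum>k. kern x z * (p k * gamma_dens k z * (1 - f z ^ k)))"
      unfolding D_def using D_summable z fm by (intro suminf_mult[symmetric]) auto
    then show "(\<Sum>k. p k * ?u k z) = kern x z * D z (f z)"
      by (simp add: mult_ac)
  qed
  finally show ?thesis using p_sums by (simp add: sums_iff)
qed

end


subsection \<open>The series for the principal eigenfunction\<close>

lemma exp_tail_integral:
  fixes d :: real
  assumes "d > 0"
  shows "(LINT z:{y..}|lebesgue. exp (- (d * z))) = exp (- (d * y)) / d"
proof -
  have "((\<lambda>z. exp (- (d * z))) has_integral exp (- (d * y)) / d) {y..}"
    using has_integral_exp_minus_to_infinity[OF assms, of y] by simp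
  moreover from this have "set_integrable lebesgue {y..} (\<lambda>z. exp (- (d * z)))"
    by (intro nonnegative_absolutely_integrable_1) (auto simp: integrable_on_def)
  ultimately show ?thesis
    by (simp add: set_lebesgue_integral_eq_integral(2) integral_unique)
qed

text \<open>For d = c(i+1) the denominator contains (i+1)^2, the factor by which the bound on
  \<open>G\<close> improves from i to i + 1.\<close>

lemma exp_weighted_tail_integral:
  fixes d :: real
  assumes "d > 0" "x \<ge> 0"
  shows "(LINT z|half_line. max 0 (z - x) * exp (- (d * z))) = exp (- (d * x)) / d\<^sup>2"
proof -
  have "(LINT z|half_line. max 0 (z - x) * exp (- (d * z)))
      = (LINT y:{x..}|lebesgue. (LINT z:{y..}|lebesgue. exp (- (d * z))))"
    using integrable_power_exp_half_line[OF assms(1), of 1] integrable_power_exp_half_line[OF assms(1), of 0]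
    by (intro iterated_integral_tail[symmetric] assms(2) borel_measurable_half_line) simp_all
  also have "\<dots> = (LINT y:{x..}|lebesgue. exp (- (d * y)) / d)"
    by (simp only: exp_tail_integral[OF assms(1)])
  also have "\<dots> = (exp (- (d * x)) / d) / d"
    by (simp add: exp_tail_integral[OF assms(1)])
  finally show ?thesis by (simp add: power2_eq_square)
qed

lemma measurable_tail_integral:
  fixes w :: "real \<Rightarrow> real"
  assumes [measurable]: "w \<in> borel_measurable half_line"
  shows "(\<lambda>x. LINT z|half_line. max 0 (z - x) * w z) \<in> borel_measurable half_line"
proof -
  have "(\<lambda>(x, z). max 0 (z - x) * w z) \<in> borel_measurable (half_line \<Otimes>\<^sub>M half_line)"
    by measurable
  then show ?thesis by (rule half_line.borel_measurable_lebesgue_integral)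
qed

context offspring
begin

text \<open>Otherwise all the mass sits at one offspring, against P(1) < 1. Strict positivity of
  \<open>g2\<close> and of \<open>D\<close> rests on this.\<close>

lemma ex_p_Suc_pos: "\<exists>k. p (Suc k) > 0"
proof (rule ccontr)
  assume "\<not> ?thesis"
  then have "p (Suc k) = 0" for k using p_nonneg[of "Suc k"] by (simp add: not_less antisym)
  then have "p sums p 0"
    using sums_finite[of "{0}" p] by (metis One_nat_def finite.intros insertCI not0_implies_Suc sum.insert sum.empty finite.emptyI empty_iff add_0_right)
  then have "p 0 = 1" using p_sums sums_unique2 by blast
  then show False using P1 by (simp add: p_def)
qed

lemma g2_pos: assumes "z > 0" shows "0 < g2 P z"
proof -
  obtain k where k: "p (Suc k) > 0" using ex_p_Suc_pos by blast
  have "0 < p (Suc k) * gamma_dens k z" using k gamma_dens_pos[OF assms] by simp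
  also have "\<dots> \<le> (\<Sum>k. p (Suc k) * gamma_dens k z)"
    using sum_le_suminf[OF g2_summable[of z], of "{k}"] assms p_nonneg gamma_dens_nonneg[of z] by simp
  finally show ?thesis by (simp add: g2_eq)
qed

text \<open>The factor \<open>c\<^sup>2\<close> cancels the two integrations of \<open>e\<^sup>-\<^sup>c\<^sup>z\<close> in the recursion for
  \<open>G\<close>, which leads to the bound \<open>K\<^sup>i / (i!)\<^sup>2\<close> on the \<open>i\<close>-th function.\<close>

definition G_const :: real where
  "G_const = (SOME K. K > 0 \<and> (\<exists>c>0. \<forall>z\<ge>0. g2 P z \<le> K * c\<^sup>2 * exp (- (c * z))))"

lemma G_const_props: "G_const > 0" "\<exists>c>0. \<forall>z\<ge>0. g2 P z \<le> G_const * c\<^sup>2 * exp (- (c * z))"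
proof -
  obtain C c where C: "C > 0" "c > 0" "\<And>z. z \<ge> 0 \<Longrightarrow> g2 P z \<le> C * exp (- (c * z))"
    using exponential_bounds by blast
  then have "C / c\<^sup>2 > 0 \<and> (\<exists>d>0. \<forall>z\<ge>0. g2 P z \<le> C / c\<^sup>2 * d\<^sup>2 * exp (- (d * z)))"
    by (intro conjI exI[of _ c]) auto
  then have "\<exists>K. K > 0 \<and> (\<exists>c>0. \<forall>z\<ge>0. g2 P z \<le> K * c\<^sup>2 * exp (- (c * z)))"
    by (rule exI[where x = "C / c\<^sup>2"])
  then have "G_const > 0 \<and> (\<exists>c>0. \<forall>z\<ge>0. g2 P z \<le> G_const * c\<^sup>2 * exp (- (c * z)))"
    unfolding G_const_def by (rule someI_ex)
  then show "G_const > 0" "\<exists>c>0. \<forall>z\<ge>0. g2 P z \<le> G_const * c\<^sup>2 * exp (- (c * z))" by auto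
qed

definition G_bound :: "nat \<Rightarrow> real" where
  "G_bound i = G_const ^ i / (fact i)\<^sup>2"

lemma G_bound_pos: "0 < G_bound i"
  using G_const_props(1) by (simp add: G_bound_def)

lemma G_bound_le: "G_bound i \<le> G_const ^ i / fact i"
proof -
  have "(fact i :: real) \<le> (fact i)\<^sup>2"
    by (simp add: power2_eq_square)
  then show ?thesis
    using G_const_props(1) unfolding G_bound_def by (intro divide_left_mono) auto
qed

lemma G_bound_summable: "summable (\<lambda>i. G_bound i * s ^ i)"
proof (rule summable_comparison_test'[of _ 0])
  show "summable (\<lambda>i. (G_const * \<bar>s\<bar>) ^ i /\<^sub>R fact i)" by (rule summable_exp_generic)
  fix i
  have "G_bound i * \<bar>s\<bar> ^ i \<le> G_const ^ i / fact i * \<bar>s\<bar> ^ i"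
    by (intro mult_right_mono G_bound_le) simp
  then show "norm (G_bound i * s ^ i) \<le> (G_const * \<bar>s\<bar>) ^ i /\<^sub>R fact i"
    using G_bound_pos[of i] by (simp add: abs_mult power_abs power_mult_distrib divide_inverse mult_ac)
qed

text \<open>The induction carries the stronger bound with the factor exp(-c i x): each
  multiplication by \<open>g2\<close> raises the decay rate by c, and the two integrations then
  divide by (c(i+1))^2. Without that factor the bound would be only K^i, too weak for convergence at
  every \<beta>.\<close>

lemma G_props:
  shows "G P i \<in> borel_measurable half_line"
    and "x \<ge> 0 \<Longrightarrow> 0 \<le> G P i x"
    and "x \<ge> 0 \<Longrightarrow> G P i x \<le> G_bound i"
    and "integrable half_line (\<lambda>z. g2 P z * G P i z)"
    and "integrable half_line (\<lambda>z. z * (g2 P z * G P i z))"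
    and "x \<ge> 0 \<Longrightarrow> G P (Suc i) x = (LINT z|half_line. max 0 (z - x) * (g2 P z * G P i z))"
proof -
  obtain c where c: "c > 0" "\<And>z. z \<ge> 0 \<Longrightarrow> g2 P z \<le> G_const * c\<^sup>2 * exp (- (c * z))"
    using G_const_props(2) by blast
  have step: "integrable half_line (\<lambda>z. g2 P z * G P i z)" (is ?A)
     "integrable half_line (\<lambda>z. z * (g2 P z * G P i z))" (is ?B)
     "\<forall>x\<ge>0. G P (Suc i) x = (LINT z|half_line. max 0 (z - x) * (g2 P z * G P i z))" (is ?C)
     "G P (Suc i) \<in> borel_measurable half_line \<and> (\<forall>x\<ge>0. 0 \<le> G P (Suc i) x \<and>
      G P (Suc i) x \<le> G_bound (Suc i) * exp (- (c * real (Suc i) * x)))" (is ?E)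
    if IH: "G P i \<in> borel_measurable half_line"
      "\<forall>x\<ge>0. 0 \<le> G P i x \<and> G P i x \<le> G_bound i * exp (- (c * real i * x))" for i
  proof -
    let ?d = "c * real (Suc i)"
    let ?w = "\<lambda>z. g2 P z * G P i z"
    let ?M = "G_bound i * (G_const * c\<^sup>2)"
    have d: "?d > 0" using c(1) by simp
    have wm: "?w \<in> borel_measurable half_line"
      by (rule borel_measurable_times[OF g2_half_line IH(1)])
    have w0: "0 \<le> ?w z" if "z \<ge> 0" for z
      using IH(2) that g2_nonneg[OF that] by simp
    have wle: "?w z \<le> ?M * exp (- (?d * z))" if "z \<ge> 0" for z
    proof -
      have "?w z \<le> (G_const * c\<^sup>2 * exp (- (c * z))) * (G_bound i * exp (- (c * real i * z)))"
        using IH(2) that c(2)[OF that] g2_nonneg[OF that] G_const_props(1) by (intro mult_mono) auto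
      also have "\<dots> = ?M * (exp (- (c * z)) * exp (- (c * real i * z)))" by simp
      also have "exp (- (c * z)) * exp (- (c * real i * z)) = exp (- (?d * z))"
        by (simp add: algebra_simps flip: exp_add)
      finally show ?thesis .
    qed
    have int: "integrable half_line (\<lambda>z. z ^ n * ?w z)" for n
    proof (rule integrable_half_line_bound)
      show "integrable half_line (\<lambda>z. ?M * (z ^ n * exp (- (?d * z))))"
        by (rule integrable_mult_right[OF integrable_power_exp_half_line[OF d]])
      show "(\<lambda>z. z ^ n * ?w z) \<in> borel_measurable half_line"
        by (rule borel_measurable_times[OF borel_measurable_power[OF ident_half_line] wm])
      show "\<bar>z ^ n * ?w z\<bar> \<le> ?M * (z ^ n * exp (- (?d * z)))" if "z \<ge> 0" for z
        using mult_left_mono[OF wle[OF that], of "z ^ n"] that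
        by (simp only: abs_of_nonneg[OF mult_nonneg_nonneg[OF zero_le_power[OF that] w0[OF that]]])
          (simp add: mult_ac)
    qed
    show ?A using int[of 0] by simp
    show ?B using int[of 1] by simp
    show C: ?C
      using iterated_integral_tail[OF _ wm w0] int[of 0] int[of 1] by simp
    show ?E
    proof (intro conjI allI impI)
      have "(\<lambda>x. LINT z|half_line. max 0 (z - x) * ?w z) \<in> borel_measurable half_line"
        by (rule measurable_tail_integral[OF wm])
      then show "G P (Suc i) \<in> borel_measurable half_line"
        using C by (subst measurable_cong[where g = "\<lambda>x. LINT z|half_line. max 0 (z - x) * ?w z"]) auto
      fix x :: real assume x: "x \<ge> 0"
      have eq: "G P (Suc i) x = (LINT z|half_line. max 0 (z - x) * ?w z)" using C x by blast
      show "0 \<le> G P (Suc i) x"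
        unfolding eq by (intro half_line_integral_nonneg mult_nonneg_nonneg w0) auto
      have mm: "(\<lambda>z. max 0 (z - x)) \<in> borel_measurable half_line"
        by (rule borel_measurable_half_line) measurable
      have xm: "(\<lambda>z. max 0 (z - x) * ?w z) \<in> borel_measurable half_line"
        by (rule borel_measurable_times[OF mm wm])
      have zx: "max 0 (z - x) \<le> z" if "z \<ge> 0" for z using x that by simp
      have "G P (Suc i) x \<le> (LINT z|half_line. ?M * (max 0 (z - x) * exp (- (?d * z))))"
        unfolding eq
      proof (rule half_line_integral_mono)
        show "integrable half_line (\<lambda>z. max 0 (z - x) * ?w z)"
        proof (rule integrable_half_line_bound[OF _ xm])
          show "integrable half_line (\<lambda>z. z * ?w z)" using int[of 1] by simp
          show "\<bar>max 0 (z - x) * ?w z\<bar> \<le> z * ?w z" if "z \<ge> 0" for z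
            using mult_right_mono[OF zx[OF that] w0[OF that]]
            by (simp only: abs_of_nonneg[OF mult_nonneg_nonneg[OF max.cobounded1 w0[OF that]]])
        qed
        show "integrable half_line (\<lambda>z. ?M * (max 0 (z - x) * exp (- (?d * z))))"
        proof (rule integrable_mult_right, rule integrable_half_line_bound)
          show "integrable half_line (\<lambda>z. z ^ 1 * exp (- (?d * z)))"
            by (rule integrable_power_exp_half_line[OF d])
          show "(\<lambda>z. max 0 (z - x) * exp (- (?d * z))) \<in> borel_measurable half_line"
            by (rule borel_measurable_half_line) measurable
          show "\<bar>max 0 (z - x) * exp (- (?d * z))\<bar> \<le> z ^ 1 * exp (- (?d * z))" if "z \<ge> 0" for z
            using zx[OF that] by (simp add: abs_mult)
        qed
        show "max 0 (z - x) * ?w z \<le> ?M * (max 0 (z - x) * exp (- (?d * z)))" if "z \<ge> 0" for z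
          using mult_left_mono[OF wle[OF that], of "max 0 (z - x)"] by (simp add: mult_ac)
      qed
      also have "\<dots> = ?M * (exp (- (?d * x)) / ?d\<^sup>2)"
        by (simp only: integral_mult_right_zero exp_weighted_tail_integral[OF d x])
      also have "?M * (exp (- (?d * x)) / ?d\<^sup>2) = ?M / ?d\<^sup>2 * exp (- (?d * x))" by simp
      also have "?M / ?d\<^sup>2 = G_bound (Suc i)"
        using c(1) unfolding G_bound_def fact_Suc by (simp add: power_mult_distrib mult_ac del: of_nat_Suc)
      finally show "G P (Suc i) x \<le> G_bound (Suc i) * exp (- (?d * x))" .
    qed
  qed
  have all: "G P i \<in> borel_measurable half_line \<and>
      (\<forall>x\<ge>0. 0 \<le> G P i x \<and> G P i x \<le> G_bound i * exp (- (c * real i * x)))" for i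
  proof (induction i)
    case 0
    then show ?case by (simp add: G_bound_def)
  next
    case (Suc i)
    then show ?case using step(4)[of i] by blast
  qed
  show "G P i \<in> borel_measurable half_line" using all by blast
  show "0 \<le> G P i x" if "x \<ge> 0" using all that by blast
  show "G P i x \<le> G_bound i" if "x \<ge> 0"
  proof -
    have "G P i x \<le> G_bound i * exp (- (c * real i * x))" using all that by blast
    also have "\<dots> \<le> G_bound i"
      using that c(1) G_bound_pos[of i] by (intro mult_left_le) auto
    finally show ?thesis .
  qed
  show "integrable half_line (\<lambda>z. g2 P z * G P i z)"
    "integrable half_line (\<lambda>z. z * (g2 P z * G P i z))"
    "x \<ge> 0 \<Longrightarrow> G P (Suc i) x = (LINT z|half_line. max 0 (z - x) * (g2 P z * G P i z))"
    using step(1-3)[of i] all[of i] by blast+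
qed


text \<open>The series of \<open>L\<close> with s = 1/\<beta>: the largest \<beta> becomes the least
  positive s, and s = 0 is available as a starting point at which the value is 1.\<close>

definition Ls :: "real \<Rightarrow> real \<Rightarrow> real" where
  "Ls s x = (\<Sum>i. G P i x * (- s) ^ i)"

definition L_bound :: "real \<Rightarrow> real" where
  "L_bound s = (\<Sum>i. G_bound i * s ^ i)"

lemma isCont_L_bound: "isCont L_bound s"
proof -
  have "isCont (\<lambda>s. \<Sum>i. G_bound i * s ^ i) s"
    by (rule isCont_powser_converges_everywhere) (rule G_bound_summable)
  then show ?thesis by (simp add: L_bound_def[abs_def])
qed

lemma Ls_term_bound:
  assumes "x \<ge> 0" "s \<ge> 0" shows "\<bar>G P i x * (- s) ^ i\<bar> \<le> G_bound i * s ^ i"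
proof -
  have "\<bar>G P i x * (- s) ^ i\<bar> = G P i x * s ^ i"
    using assms G_props(2)[of x i] by (simp add: abs_mult power_abs)
  also have "\<dots> \<le> G_bound i * s ^ i"
    using assms G_props(3)[of x i] by (intro mult_right_mono) auto
  finally show ?thesis .
qed

lemma Ls_summable:
  assumes "x \<ge> 0" "s \<ge> 0" shows "summable (\<lambda>i. G P i x * (- s) ^ i)"
  by (rule summable_comparison_test'[OF G_bound_summable[of s], of 0])
    (use Ls_term_bound[OF assms] in simp)

lemma abs_Ls_le:
  assumes "x \<ge> 0" "s \<ge> 0" shows "\<bar>Ls s x\<bar> \<le> L_bound s"
  unfolding Ls_def L_bound_def real_norm_def[symmetric]
  by (rule norm_suminf_le) (use Ls_term_bound[OF assms] G_bound_summable in auto)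

text \<open>Termwise, the powers of -t and -s differ by t^i - s^i in absolute value. The bound does
  not involve x, so continuity of \<open>L_bound\<close> gives continuity in s uniformly over the
  half-line.\<close>

lemma abs_Ls_diff_le:
  assumes "x \<ge> 0" "0 \<le> s" "s \<le> t" shows "\<bar>Ls t x - Ls s x\<bar> \<le> L_bound t - L_bound s"
proof -
  have "Ls t x - Ls s x = (\<Sum>i. G P i x * (- t) ^ i - G P i x * (- s) ^ i)"
    unfolding Ls_def using assms by (intro suminf_diff Ls_summable) auto
  also have "\<bar>\<dots>\<bar> \<le> (\<Sum>i. G_bound i * t ^ i - G_bound i * s ^ i)"
    unfolding real_norm_def[symmetric]
  proof (rule norm_suminf_le)
    show "summable (\<lambda>i. G_bound i * t ^ i - G_bound i * s ^ i)"
      by (intro summable_diff G_bound_summable)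
    fix i
    have st: "s ^ i \<le> t ^ i" using assms by (intro power_mono)
    have "G P i x * (- t) ^ i - G P i x * (- s) ^ i = G P i x * ((- 1) ^ i * (t ^ i - s ^ i))"
      by (simp add: power_minus[of t] power_minus[of s] algebra_simps)
    then have "norm (G P i x * (- t) ^ i - G P i x * (- s) ^ i) = G P i x * (t ^ i - s ^ i)"
      using st G_props(2)[OF assms(1), of i] by (simp add: abs_mult power_abs)
    also have "\<dots> \<le> G_bound i * (t ^ i - s ^ i)"
      using st G_props(3)[OF assms(1), of i] by (intro mult_right_mono) auto
    finally show "norm (G P i x * (- t) ^ i - G P i x * (- s) ^ i) \<le> G_bound i * t ^ i - G_bound i * s ^ i"
      by (simp add: right_diff_distrib)
  qed
  also have "\<dots> = L_bound t - L_bound s"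
    unfolding L_bound_def by (rule suminf_diff[symmetric]) (rule G_bound_summable)+
  finally show ?thesis .
qed

lemma Ls_half_line: "Ls s \<in> borel_measurable half_line"
  unfolding Ls_def[abs_def]
  by (intro borel_measurable_suminf borel_measurable_times G_props(1)) simp

lemma integrable_g2_Ls:
  assumes "s \<ge> 0" "w \<in> borel_measurable half_line" "\<And>z. z \<ge> 0 \<Longrightarrow> \<bar>w z\<bar> \<le> z"
  shows "integrable half_line (\<lambda>z. w z * (g2 P z * Ls s z))"
proof (rule integrable_half_line_bound)
  show "integrable half_line (\<lambda>z. L_bound s * (z ^ 1 * g2 P z))"
    by (rule integrable_mult_right) (rule integrable_power_g2)
  show "(\<lambda>z. w z * (g2 P z * Ls s z)) \<in> borel_measurable half_line"
    by (rule borel_measurable_times[OF assms(2) borel_measurable_times[OF g2_half_line Ls_half_line]])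
  show "\<bar>w z * (g2 P z * Ls s z)\<bar> \<le> L_bound s * (z ^ 1 * g2 P z)" if "z \<ge> 0" for z
  proof -
    have "\<bar>w z * (g2 P z * Ls s z)\<bar> = \<bar>w z\<bar> * (g2 P z * \<bar>Ls s z\<bar>)"
      using g2_nonneg[OF that] by (simp add: abs_mult)
    also have "\<dots> \<le> z * (g2 P z * L_bound s)"
      using g2_nonneg[OF that] that by (intro mult_mono assms(3) abs_Ls_le assms(1)) auto
    finally show ?thesis by (simp add: mult_ac)
  qed
qed

lemma max_half_line:
  "(\<lambda>z. max 0 (z - x)) \<in> borel_measurable half_line"
  "x \<ge> 0 \<Longrightarrow> z \<ge> 0 \<Longrightarrow> \<bar>max 0 (z - x)\<bar> \<le> (z::real)"
proof -
  show "(\<lambda>z. max 0 (z - x)) \<in> borel_measurable half_line"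
    by (rule borel_measurable_half_line) measurable
qed auto

text \<open>The recursion for \<open>G\<close>, summed under the integral. Formally this is the
  equation u'' = -s \<open>g2\<close> u with value 1 and slope 0 at infinity.\<close>

lemma Ls_eq:
  assumes x: "x \<ge> 0" and s: "s \<ge> 0"
  shows "Ls s x = 1 - s * (LINT z|half_line. max 0 (z - x) * (g2 P z * Ls s z))"
proof -
  let ?f = "\<lambda>i z. (- s) ^ i * (max 0 (z - x) * (g2 P z * G P i z))"
  have int: "integrable half_line (\<lambda>z. max 0 (z - x) * (g2 P z * G P i z))" for i
  proof (rule integrable_half_line_bound[OF G_props(5)[of i]])
    show "(\<lambda>z. max 0 (z - x) * (g2 P z * G P i z)) \<in> borel_measurable half_line"
      by (rule borel_measurable_times[OF max_half_line(1) borel_measurable_times[OF g2_half_line G_props(1)]])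
    fix z :: real assume z: "z \<ge> 0"
    have w0: "0 \<le> g2 P z * G P i z"
      using z by (intro mult_nonneg_nonneg g2_nonneg G_props(2))
    have "max 0 (z - x) * (g2 P z * G P i z) \<le> z * (g2 P z * G P i z)"
      using x z by (intro mult_right_mono w0) auto
    then show "\<bar>max 0 (z - x) * (g2 P z * G P i z)\<bar> \<le> z * (g2 P z * G P i z)"
      by (simp only: abs_of_nonneg[OF mult_nonneg_nonneg[OF max.cobounded1 w0]])
  qed
  have f_int: "integral\<^sup>L half_line (?f i) = (- s) ^ i * G P (Suc i) x" for i
    by (simp only: integral_mult_right_zero G_props(6)[OF x])
  have norm_int: "(LINT z|half_line. norm (?f i z)) = s ^ i * G P (Suc i) x" for i
  proof -
    have "norm (?f i z) = s ^ i * (max 0 (z - x) * (g2 P z * G P i z))" if "z \<ge> 0" for z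
      using s g2_nonneg[OF that] G_props(2)[OF that, of i] by (simp add: abs_mult power_abs)
    then have "(LINT z|half_line. norm (?f i z))
        = (LINT z|half_line. s ^ i * (max 0 (z - x) * (g2 P z * G P i z)))"
      by (rule half_line_integral_cong)
    then show ?thesis by (simp only: integral_mult_right_zero G_props(6)[OF x])
  qed
  have "(\<Sum>i. G P i x * (- s) ^ i) = (\<Sum>i. G P (Suc i) x * (- s) ^ Suc i) + G P 0 x * (- s) ^ 0"
    using suminf_split_head[OF Ls_summable[OF x s]] by simp
  then have "Ls s x = 1 + (\<Sum>i. (- s) * integral\<^sup>L half_line (?f i))"
    unfolding Ls_def f_int by (simp add: mult_ac)
  also have "(\<Sum>i. (- s) * integral\<^sup>L half_line (?f i)) = (- s) * (\<Sum>i. integral\<^sup>L half_line (?f i))"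
  \<comment> \<open>Summability of the integrals is recovered from the series of \<open>Ls\<close>
    by dividing by -s.\<close>
  proof (cases "s = 0")
    case False
    have "summable (\<lambda>i. G P (Suc i) x * (- s) ^ Suc i)"
      using Ls_summable[OF x s] by (subst summable_Suc_iff)
    then have "summable (\<lambda>i. (- 1 / s) * (G P (Suc i) x * (- s) ^ Suc i))"
      by (rule summable_mult)
    then have "summable (\<lambda>i. integral\<^sup>L half_line (?f i))"
      unfolding f_int using False by (simp add: mult_ac)
    then show ?thesis by (rule suminf_mult)
  qed simp
  also have "(\<Sum>i. integral\<^sup>L half_line (?f i)) = (LINT z|half_line. (\<Sum>i. ?f i z))"
  proof (rule integral_suminf[symmetric])
    show "integrable half_line (?f i)" for i by (rule integrable_mult_right[OF int])
    show "AE z in half_line. summable (\<lambda>i. norm (?f i z))"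
    proof (rule AE_half_line_cong)
      fix z :: real assume z: "z \<ge> 0"
      have "summable (\<lambda>i. norm (G P i z * (- s) ^ i))"
        by (rule summable_comparison_test'[OF G_bound_summable[of s], of 0])
          (use Ls_term_bound[OF z s] in simp)
      then have "summable (\<lambda>i. \<bar>max 0 (z - x) * g2 P z\<bar> * norm (G P i z * (- s) ^ i))"
        by (rule summable_mult)
      then show "summable (\<lambda>i. norm (?f i z))"
        by (simp add: abs_mult mult_ac)
    qed
    have bnd: "s ^ i * G P (Suc i) x \<le> (G_const * s) ^ i /\<^sub>R fact i * G_const" for i
    proof -
      have "G P (Suc i) x \<le> G_const ^ Suc i / fact (Suc i)"
        using G_props(3)[OF x, of "Suc i"] G_bound_le[of "Suc i"] by linarith
      also have "\<dots> \<le> G_const ^ Suc i / fact i"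
        using G_const_props(1) fact_mono[of i "Suc i", where 'a = real] by (intro divide_left_mono) auto
      finally have "s ^ i * G P (Suc i) x \<le> s ^ i * (G_const ^ Suc i / fact i)"
        using s by (intro mult_left_mono) auto
      then show ?thesis by (simp add: power_mult_distrib divide_inverse mult_ac)
    qed
    have "summable (\<lambda>i. (G_const * s) ^ i /\<^sub>R fact i * G_const)"
      by (intro summable_mult2 summable_exp_generic)
    then have "summable (\<lambda>i. s ^ i * G P (Suc i) x)"
      by (rule summable_nonneg_le) (rule mult_nonneg_nonneg[OF zero_le_power[OF s] G_props(2)[OF x]] bnd)+
    then show "summable (\<lambda>i. LINT z|half_line. norm (?f i z))"
      by (simp only: norm_int)
  qed
  also have "(LINT z|half_line. (\<Sum>i. ?f i z)) = (LINT z|half_line. max 0 (z - x) * (g2 P z * Ls s z))"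
  proof (rule half_line_integral_cong)
    fix z :: real assume z: "z \<ge> 0"
    have "(max 0 (z - x) * g2 P z) * Ls s z = (\<Sum>i. (max 0 (z - x) * g2 P z) * (G P i z * (- s) ^ i))"
      unfolding Ls_def by (rule suminf_mult[symmetric]) (rule Ls_summable[OF z s])
    then show "(\<Sum>i. ?f i z) = max 0 (z - x) * (g2 P z * Ls s z)"
      by (simp add: mult_ac)
  qed
  finally show ?thesis by simp
qed

section \<open>Positivity and the least root in s\<close>

lemma Ls_0: "Ls 0 x = 1"
proof -
  have "(\<lambda>i. G P i x * 0 ^ i) sums G P 0 x" by (rule powser_sums_zero)
  then show ?thesis unfolding Ls_def by (simp add: sums_iff)
qed

text \<open>Since z - max(0,z-x) = min(x,z), subtracting two instances of \<open>Ls_eq\<close>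
  removes the constant. If \<open>Ls s 0\<close> vanishes, this is the eigenvalue equation with
  eigenvalue 1/s.\<close>

lemma Ls_diff_0:
  assumes x: "x \<ge> 0" and s: "s \<ge> 0"
  shows "Ls s x - Ls s 0 = s * (LINT z|half_line. min x z * (g2 P z * Ls s z))"
proof -
  have i: "integrable half_line (\<lambda>z. max 0 (z - x) * (g2 P z * Ls s z))" if "x \<ge> 0" for x
    by (rule integrable_g2_Ls[OF s max_half_line(1) max_half_line(2)[OF that]])
  have "Ls s x - Ls s 0 = s * ((LINT z|half_line. max 0 (z - 0) * (g2 P z * Ls s z))
      - (LINT z|half_line. max 0 (z - x) * (g2 P z * Ls s z)))"
    by (simp only: Ls_eq[OF x s] Ls_eq[OF order.refl s] right_diff_distrib)
  also have "\<dots> = s * (LINT z|half_line. max 0 (z - 0) * (g2 P z * Ls s z)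
      - max 0 (z - x) * (g2 P z * Ls s z))"
    by (simp only: Bochner_Integration.integral_diff[OF i[OF order.refl] i[OF x]])
  also have "(LINT z|half_line. max 0 (z - 0) * (g2 P z * Ls s z) - max 0 (z - x) * (g2 P z * Ls s z))
      = (LINT z|half_line. min x z * (g2 P z * Ls s z))"
    by (rule half_line_integral_cong) (use x in \<open>auto simp: max_def min_def algebra_simps\<close>)
  finally show ?thesis .
qed

lemma integrable_min_g2_Ls:
  assumes "s \<ge> 0" "x \<ge> 0"
  shows "integrable half_line (\<lambda>z. min x z * (g2 P z * Ls s z))"
proof (rule integrable_g2_Ls[OF assms(1)])
  show "min x \<in> borel_measurable half_line" by (rule borel_measurable_half_line) measurable
qed (use assms in auto)

lemma Ls_mono:
  assumes s: "s \<ge> 0" and pos: "\<And>z. z \<ge> 0 \<Longrightarrow> 0 \<le> Ls s z" and xy: "0 \<le> x" "x \<le> y"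
  shows "Ls s x \<le> Ls s y"
proof -
  have y: "0 \<le> y" using xy by simp
  have "(LINT z|half_line. min x z * (g2 P z * Ls s z)) \<le> (LINT z|half_line. min y z * (g2 P z * Ls s z))"
  proof (rule half_line_integral_mono[OF integrable_min_g2_Ls[OF s xy(1)] integrable_min_g2_Ls[OF s y]])
    fix z :: real assume z: "z \<ge> 0"
    show "min x z * (g2 P z * Ls s z) \<le> min y z * (g2 P z * Ls s z)"
      by (rule mult_right_mono[OF min.mono[OF xy(2) order.refl]
            mult_nonneg_nonneg[OF g2_nonneg[OF z] pos[OF z]]])
  qed
  then have "Ls s x - Ls s 0 \<le> Ls s y - Ls s 0"
    unfolding Ls_diff_0[OF xy(1) s] Ls_diff_0[OF y s] using s by (rule mult_left_mono)
  then show ?thesis by simp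
qed

text \<open>Look at x = 1: restricting the integral in \<open>Ls_diff_0\<close> to z \<ge> 1, where
  monotonicity gives \<open>Ls s z\<close> \<ge> \<open>Ls s 1\<close>, yields \<open>Ls s 1\<close>
  \<ge> s \<kappa> \<open>Ls s 1\<close> with \<kappa> the integral of \<open>g2\<close> over
  [1,\<infinity>). Hence s \<le> 1/\<kappa>, and positivity must eventually fail.\<close>

lemma Ls_positive_bounded: "\<exists>B. \<forall>s\<ge>0. (\<forall>x\<ge>0. 0 < Ls s x) \<longrightarrow> s \<le> B"
proof -
  let ?w = "\<lambda>z. indicator {1..} z * g2 P z"
  have wm: "?w \<in> borel_measurable half_line"
    by (intro borel_measurable_times g2_half_line borel_measurable_half_line) simp
  have wi: "integrable half_line ?w"
  proof (rule integrable_half_line_bound[OF _ wm])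
    show "integrable half_line (g2 P)" using integrable_power_g2[of 0] by simp
    show "\<bar>?w z\<bar> \<le> g2 P z" if "z \<ge> 0" for z
      using g2_nonneg[OF that] by (simp add: indicator_def)
  qed
  let ?\<kappa> = "integral\<^sup>L half_line ?w"
  have "?\<kappa> > 0"
  proof (rule ccontr)
    assume "\<not> ?\<kappa> > 0"
    moreover have "0 \<le> ?\<kappa>"
      by (rule half_line_integral_nonneg) (simp add: g2_nonneg)
    ultimately have "?\<kappa> = 0" by simp
    moreover have "AE z in half_line. 0 \<le> ?w z"
      by (rule AE_half_line_cong) (simp add: g2_nonneg)
    ultimately have "AE z in half_line. ?w z = 0"
      using integral_nonneg_eq_0_iff_AE[OF wi] by blast
    then have "AE z in half_line. z \<notin> {1..2::real}"
    proof eventually_elim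
      case (elim z)
      then show ?case using g2_pos[of z] by (auto simp: indicator_def)
    qed
    then have "emeasure half_line {1..2::real} = 0"
      by (subst (asm) AE_iff_measurable[where N = "{1..2}"]) (auto simp: sets_restrict_space_iff)
    then show False by (subst (asm) emeasure_restrict_space) auto
  qed
  have "s \<le> 1 / ?\<kappa>" if s: "s \<ge> 0" and pos: "\<forall>x\<ge>0. 0 < Ls s x" for s
  proof -
    have "(LINT z|half_line. Ls s 1 * ?w z) \<le> (LINT z|half_line. min 1 z * (g2 P z * Ls s z))"
    proof (rule half_line_integral_mono)
      show "Ls s 1 * ?w z \<le> min 1 z * (g2 P z * Ls s z)" if "z \<ge> 0" for z
      proof (cases "1 \<le> z")
        case True
        then have "Ls s 1 \<le> Ls s z" using s pos by (intro Ls_mono) (auto intro: less_imp_le)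
        then show ?thesis using True g2_nonneg[OF that] by (simp add: mult.commute mult_left_mono)
      next
        case False
        have "0 \<le> g2 P z * Ls s z" using g2_nonneg[OF that] pos that by (simp add: less_imp_le)
        then show ?thesis using False that by simp
      qed
    qed (rule integrable_mult_right[OF wi] integrable_min_g2_Ls[OF s zero_le_one])+
    then have "s * (Ls s 1 * ?\<kappa>) \<le> Ls s 1 - Ls s 0"
      unfolding Ls_diff_0[OF zero_le_one s] using s by (intro mult_left_mono) auto
    also have "\<dots> \<le> Ls s 1" using pos by (simp add: less_imp_le)
    finally have "(s * ?\<kappa>) * Ls s 1 \<le> 1 * Ls s 1" by (simp add: mult_ac)
    then have "s * ?\<kappa> \<le> 1" by (rule mult_right_le_imp_le) (use pos in simp)
    then show ?thesis using \<open>?\<kappa> > 0\<close> by (simp add: field_simps)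
  qed
  then show ?thesis by blast
qed


text \<open>Take the supremum of those \<open>s\<close> up to which all the functions \<open>Ls t\<close> are positive. Positivity
  cannot first be lost at some \<open>x > 0\<close>, since a nonnegative \<open>Ls s\<close> is nondecreasing in \<open>x\<close>.\<close>

lemma least_root:
  obtains s where "s > 0" "Ls s 0 = 0" "\<And>x. x \<ge> 0 \<Longrightarrow> 0 \<le> Ls s x"
    "\<And>t. 0 \<le> t \<Longrightarrow> t < s \<Longrightarrow> 0 < Ls t 0"
proof -
  \<comment> \<open>Quantifying over all t up to s makes E an interval from 0, so positivity holds
    at every t below its supremum.\<close>
  define E where "E = {s. 0 \<le> s \<and> (\<forall>t\<in>{0..s}. \<forall>x\<ge>0. 0 < Ls t x)}"
  have zero: "0 \<in> E" by (auto simp: E_def Ls_0)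
  have bdd: "bdd_above E"
  proof -
    obtain B where "\<forall>s\<ge>0. (\<forall>x\<ge>0. 0 < Ls s x) \<longrightarrow> s \<le> B" using Ls_positive_bounded by blast
    then have "s \<le> B" if "s \<in> E" for s using that by (auto simp: E_def)
    then show ?thesis by (rule bdd_aboveI)
  qed
  define s where "s = Sup E"
  have s0: "s \<ge> 0" unfolding s_def by (rule cSup_upper[OF zero bdd])
  have below: "0 < Ls t x" if t: "0 \<le> t" "t < s" and x: "x \<ge> 0" for t x
  proof -
    obtain u where u: "u \<in> E" "t < u"
      using less_cSupD[of E t] zero t(2) unfolding s_def by blast
    then have "t \<in> {0..u}" using t(1) by simp
    then show ?thesis using u(1) x unfolding E_def by blast
  qed
  have nonneg: "0 \<le> Ls s x" if x: "x \<ge> 0" for x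
  proof (rule ccontr)
    assume neg: "\<not> 0 \<le> Ls s x"
    have "s \<noteq> 0" using neg by (auto simp: Ls_0)
    then have sp: "s > 0" using s0 by simp
    \<comment> \<open>Positivity is known only below s, so the limit is taken from the left; a
      negative value at s would already make \<open>Ls t x\<close> negative for t close to
      s.\<close>
    have "(L_bound \<longlongrightarrow> L_bound s) (at_left s)"
      using isCont_L_bound unfolding isCont_def by (rule filterlim_mono) (auto simp: at_le)
    then have "\<forall>\<^sub>F t in at_left s. dist (L_bound t) (L_bound s) < - Ls s x"
      by (rule tendstoD) (use neg in simp)
    moreover have "\<forall>\<^sub>F t in at_left s. t \<in> {0<..<s}"
      using eventually_at_left_real[OF sp] .
    ultimately have "\<forall>\<^sub>F t in at_left s. False"
    proof eventually_elim
      case (elim t)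
      then have "\<bar>Ls s x - Ls t x\<bar> < - Ls s x"
        using abs_Ls_diff_le[OF x, of t s] by (auto simp: dist_real_def)
      moreover have "0 < Ls t x" using elim x by (intro below) auto
      ultimately show ?case by linarith
    qed
    then show False by simp
  qed
  have root: "Ls s 0 = 0"
  proof (rule ccontr)
    assume "Ls s 0 \<noteq> 0"
    then have \<delta>: "Ls s 0 > 0" using nonneg[of 0] by simp
    \<comment> \<open>Monotonicity makes the value at 0 a positive lower bound for all x. Uniform
      continuity in s then carries positivity beyond the supremum of E, a contradiction.\<close>
    have ge: "Ls s 0 \<le> Ls s x" if "x \<ge> 0" for x
      using that by (intro Ls_mono s0 nonneg) auto
    have "(L_bound \<longlongrightarrow> L_bound s) (at s)" using isCont_L_bound unfolding isCont_def .
    then have "\<forall>\<^sub>F t in at s. dist (L_bound t) (L_bound s) < Ls s 0" by (rule tendstoD) fact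
    then obtain d where d: "d > 0" "\<And>t. t \<noteq> s \<Longrightarrow> dist t s < d \<Longrightarrow> dist (L_bound t) (L_bound s) < Ls s 0"
      unfolding eventually_at by blast
    have "0 < Ls t x" if t: "t \<in> {0..s + d / 2}" and x: "x \<ge> 0" for t x
    proof (cases "t < s")
      case True
      then show ?thesis using t x below by simp
    next
      case False
      then have "L_bound t - L_bound s < Ls s 0"
      proof (cases "t = s")
        case True
        then show ?thesis using \<delta> by simp
      next
        case neq: False
        then have "dist (L_bound t) (L_bound s) < Ls s 0"
          using False t d(1) by (intro d(2)) (auto simp: dist_real_def)
        then show ?thesis by (simp add: dist_real_def)
      qed
      then show ?thesis
        using abs_Ls_diff_le[OF x s0, of t] False ge[OF x] by linarith
    qed
    then have "s + d / 2 \<in> E" using s0 d(1) by (simp add: E_def)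
    then have "s + d / 2 \<le> s" unfolding s_def by (rule cSup_upper[OF _ bdd])
    then show False using d(1) by simp
  qed
  have "s \<noteq> 0" using root by (auto simp: Ls_0)
  then show ?thesis
    using that[of s] s0 root nonneg below[of _ 0] by simp
qed

section \<open>The principal eigenfunction\<close>

lemma L_eq_Ls: "L P \<beta> x = Ls (1 / \<beta>) x"
  by (simp add: L_def Ls_def)

text \<open>The last clause is the normalization inherited from \<open>Ls_eq\<close> at x = 0.
  Positivity at the single point 1 suffices later, because \<open>\<phi> 1\<close> is the constant
  in the lower bound of \<phi>(x)/x by \<open>kern x 1\<close>.\<close>

definition eigenpair :: "real \<Rightarrow> (real \<Rightarrow> real) \<Rightarrow> bool" where
  "eigenpair s \<phi> \<longleftrightarrow> s > 0 \<and> beta0 P = 1 / s \<and> \<phi> \<in> borel_measurable half_line \<and>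
    (\<forall>x\<ge>0. 0 \<le> \<phi> x) \<and> (\<exists>B. \<forall>x\<ge>0. \<phi> x \<le> B) \<and> \<phi> 1 > 0 \<and>
    (\<forall>x\<ge>0. \<phi> x = s * (LINT z|half_line. min x z * (g2 P z * \<phi> z))) \<and>
    s * (LINT z|half_line. z * (g2 P z * \<phi> z)) = 1"

lemma eigenpairD:
  assumes "eigenpair s \<phi>"
  shows "s > 0" "beta0 P = 1 / s" "\<phi> \<in> borel_measurable half_line" "\<phi> 1 > 0"
    "\<And>x. x \<ge> 0 \<Longrightarrow> 0 \<le> \<phi> x"
    "\<And>x. x \<ge> 0 \<Longrightarrow> \<phi> x = s * (LINT z|half_line. min x z * (g2 P z * \<phi> z))"
    "s * (LINT z|half_line. z * (g2 P z * \<phi> z)) = 1"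
  using assms unfolding eigenpair_def by blast+

lemma eigenpair_weight:
  assumes "eigenpair s \<phi>"
  shows "(\<lambda>z. g2 P z * \<phi> z) \<in> borel_measurable half_line"
    and "z \<ge> 0 \<Longrightarrow> 0 \<le> g2 P z * \<phi> z"
    and "integrable half_line (\<lambda>z. g2 P z * \<phi> z)"
    and "integrable half_line (\<lambda>z. z * (g2 P z * \<phi> z))"
proof -
  note e = eigenpairD[OF assms]
  show m: "(\<lambda>z. g2 P z * \<phi> z) \<in> borel_measurable half_line"
    by (rule borel_measurable_times[OF g2_half_line e(3)])
  show w0: "0 \<le> g2 P z * \<phi> z" if "z \<ge> 0" for z
    by (rule mult_nonneg_nonneg[OF g2_nonneg[OF that] e(5)[OF that]])
  obtain B where B: "\<forall>x\<ge>0. \<phi> x \<le> B" using assms unfolding eigenpair_def by blast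
  have int: "integrable half_line (\<lambda>z. z ^ n * (g2 P z * \<phi> z))" for n
  proof (rule integrable_half_line_bound)
    show "integrable half_line (\<lambda>z. B * (z ^ n * g2 P z))"
      by (rule integrable_mult_right) (rule integrable_power_g2)
    show "(\<lambda>z. z ^ n * (g2 P z * \<phi> z)) \<in> borel_measurable half_line"
      by (rule borel_measurable_times[OF borel_measurable_power[OF ident_half_line] m])
    fix z :: real assume z: "z \<ge> 0"
    have "z ^ n * g2 P z * \<phi> z \<le> z ^ n * g2 P z * B"
      using z B g2_nonneg[OF z] by (intro mult_left_mono) auto
    then show "\<bar>z ^ n * (g2 P z * \<phi> z)\<bar> \<le> B * (z ^ n * g2 P z)"
      unfolding abs_of_nonneg[OF mult_nonneg_nonneg[OF zero_le_power[OF z] w0[OF z]]]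
      by (simp add: mult_ac)
  qed
  show "integrable half_line (\<lambda>z. g2 P z * \<phi> z)" using int[of 0] by simp
  show "integrable half_line (\<lambda>z. z * (g2 P z * \<phi> z))" using int[of 1] by simp
qed

lemma eigenpair_exists: "\<exists>s \<phi>. eigenpair s \<phi>"
proof -
  obtain s where s: "s > 0" "Ls s 0 = 0" "\<And>x. x \<ge> 0 \<Longrightarrow> 0 \<le> Ls s x"
    "\<And>t. 0 \<le> t \<Longrightarrow> t < s \<Longrightarrow> 0 < Ls t 0"
    using least_root by (metis (no_types))
  have s0: "s \<ge> 0" using s(1) by simp
  have beta: "beta0 P = 1 / s"
    unfolding beta0_def L_eq_Ls
  \<comment> \<open>The least root s is the witness: a root \<beta> > 1/s would give a root
    1/\<beta> below s.\<close>
  proof (rule Greatest_equality)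
    show "1 / s > 0 \<and> Ls (1 / (1 / s)) 0 = 0" using s by simp
    fix \<beta> :: real assume \<beta>: "\<beta> > 0 \<and> Ls (1 / \<beta>) 0 = 0"
    then have "\<not> 1 / \<beta> < s" using s(4)[of "1 / \<beta>"] by auto
    then show "\<beta> \<le> 1 / s" using \<beta> s(1) by (simp add: field_simps not_less)
  qed
  have eig: "Ls s x = s * (LINT z|half_line. min x z * (g2 P z * Ls s z))" if "x \<ge> 0" for x
    using Ls_diff_0[OF that s0] s(2) by simp
  have tot: "s * (LINT z|half_line. z * (g2 P z * Ls s z)) = 1"
  proof -
    have "(LINT z|half_line. max 0 (z - 0) * (g2 P z * Ls s z)) = (LINT z|half_line. z * (g2 P z * Ls s z))"
      by (rule half_line_integral_cong) simp
    then show ?thesis using Ls_eq[of 0 s] s0 s(2) by simp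
  qed
  \<comment> \<open>If it vanished, so would the nonnegative integrand min(1,z) \<open>g2\<close>
    \<open>Ls\<close> almost everywhere, against the normalization just shown.\<close>
  have "Ls s 1 \<noteq> 0"
  proof
    assume "Ls s 1 = 0"
    then have "(LINT z|half_line. min 1 z * (g2 P z * Ls s z)) = 0" using eig[of 1] s(1) by simp
    moreover have "AE z in half_line. 0 \<le> min 1 z * (g2 P z * Ls s z)"
      by (intro AE_half_line_cong mult_nonneg_nonneg g2_nonneg s(3)) auto
    ultimately have "AE z in half_line. min 1 z * (g2 P z * Ls s z) = 0"
      using integral_nonneg_eq_0_iff_AE[OF integrable_min_g2_Ls[OF s0 zero_le_one]] by blast
    then have "AE z in half_line. z * (g2 P z * Ls s z) = 0"
      by eventually_elim (auto simp: min_def split: if_splits)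
    then have "(LINT z|half_line. z * (g2 P z * Ls s z)) = 0"
      by (rule integral_eq_zero_AE)
    then show False using tot by simp
  qed
  then have "Ls s 1 > 0" using s(3)[of 1] by simp
  moreover have "\<exists>B. \<forall>x\<ge>0. Ls s x \<le> B"
    using abs_Ls_le[OF _ s0] by (intro exI[of _ "L_bound s"]) (simp add: abs_le_iff)
  ultimately have "eigenpair s (Ls s)"
    unfolding eigenpair_def using s(1) beta Ls_half_line s(3) eig tot by simp
  then show ?thesis by blast
qed

end


subsection \<open>Monotonicity and continuity of the operator\<close>

context offspring
begin

abbreviation T :: "(real \<Rightarrow> real) \<Rightarrow> real \<Rightarrow> real" where
  "T \<equiv> T_op P"

lemma integrable_D0: "integrable half_line (\<lambda>z. D z 0)"
  using integrable_power_D0[of 0] by simp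

lemma const_meas_funs: "0 \<le> c \<Longrightarrow> c \<le> 1 \<Longrightarrow> (\<lambda>x\<in>{0..}. c) \<in> meas_funs"
proof -
  assume c: "0 \<le> c" "c \<le> 1"
  have "(\<lambda>x\<in>{0..}. c) \<in> borel_measurable half_line"
    by (subst measurable_cong[where g = "\<lambda>_. c"]) auto
  then show ?thesis using c by (simp add: meas_funs_def)
qed

lemma kern_D_measurable:
  assumes "f \<in> borel_measurable half_line"
  shows "(\<lambda>z. kern x z * D z (f z)) \<in> borel_measurable half_line"
  by (rule borel_measurable_times[OF kern_half_line D_half_line[OF assms]])

lemma kern_D_bounds:
  assumes "f \<in> meas_funs" "x \<ge> 0" "z \<ge> 0"
  shows "0 \<le> kern x z * D z (f z)" "kern x z * D z (f z) \<le> D z 0"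
proof -
  note f = meas_funsD(2,3)[OF assms(1,3)]
  have D: "0 \<le> D z (f z)" "D z (f z) \<le> D z 0"
    using f by (auto intro: D_nonneg D_antimono assms(3))
  then show "0 \<le> kern x z * D z (f z)" using kern_nonneg[OF assms(2,3)] by simp
  have "kern x z * D z (f z) \<le> 1 * D z (f z)"
    by (rule mult_right_mono[OF kern_le_1[OF assms(2,3)] D(1)])
  then show "kern x z * D z (f z) \<le> D z 0" using D(2) by simp
qed

lemma integrable_kern_D:
  assumes "f \<in> meas_funs" "x \<ge> 0"
  shows "integrable half_line (\<lambda>z. kern x z * D z (f z))"
  by (rule integrable_half_line_bound[OF integrable_D0 kern_D_measurable[OF meas_funsD(1)[OF assms(1)]]])
    (use kern_D_bounds[OF assms] in simp)

text \<open>The difference of the two sides is T(0)(0), which the defining series shows to be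
  nonnegative: with 0^0 = 1 only its first term survives.\<close>

lemma integral_D0_le_1: "(LINT z|half_line. D z 0) \<le> 1"
proof -
  let ?z = "\<lambda>x\<in>{0::real..}. 0 :: real"
  have z: "?z \<in> meas_funs" by (rule const_meas_funs) auto
  let ?t = "\<lambda>k. pmf P (Suc k) * (LINT z:{0..}|lebesgue. gamma_dens k z * ?z z ^ k)"
  have eq: "(LINT z:{0..}|lebesgue. gamma_dens k z * ?z z ^ k)
      = (LINT z:{0..}|lebesgue. gamma_dens k z * 0 ^ k)" for k
    by (rule set_lebesgue_integral_cong) auto
  have fin: "?t k = 0" if "k \<notin> {0}" for k
    unfolding eq using that by (simp add: power_0_left)
  have "summable ?t" by (rule summable_finite[of "{0}"]) (use fin in auto)
  moreover have "0 \<le> ?t k" for k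
    unfolding eq set_lebesgue_integral_def
    by (intro mult_nonneg_nonneg Bochner_Integration.integral_nonneg) (auto simp: indicator_def gamma_dens_nonneg)
  ultimately have "0 \<le> suminf ?t" by (rule suminf_nonneg)
  also have "suminf ?t = T ?z 0" by (simp add: T_op_def)
  also have "\<dots> = 1 - (LINT z|half_line. kern 0 z * D z (?z z))" by (rule T_eq[OF z order.refl])
  also have "(LINT z|half_line. kern 0 z * D z (?z z)) = (LINT z|half_line. D z 0)"
    by (rule half_line_integral_cong) (simp add: kern_def)
  finally show ?thesis by simp
qed

lemma T_bounds:
  assumes "f \<in> meas_funs" "x \<ge> 0" shows "0 \<le> T f x" "T f x \<le> 1"
proof -
  have "(LINT z|half_line. kern x z * D z (f z)) \<le> (LINT z|half_line. D z 0)"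
    by (rule half_line_integral_mono[OF integrable_kern_D[OF assms] integrable_D0 kern_D_bounds(2)[OF assms]])
  then show "0 \<le> T f x" using integral_D0_le_1 unfolding T_eq[OF assms] by linarith
  have "0 \<le> (LINT z|half_line. kern x z * D z (f z))"
    by (rule half_line_integral_nonneg[OF kern_D_bounds(1)[OF assms]])
  then show "T f x \<le> 1" unfolding T_eq[OF assms] by simp
qed

lemma kern_integral_measurable:
  fixes w :: "real \<Rightarrow> real"
  assumes "w \<in> borel_measurable half_line"
  shows "(\<lambda>x. LINT z|half_line. kern x z * w z) \<in> borel_measurable half_line"
proof -
  from assms have [measurable]: "(\<lambda>v. w (snd v)) \<in> borel_measurable (half_line \<Otimes>\<^sub>M half_line)"
    by (rule measurable_compose[OF measurable_snd])
  have "(\<lambda>(x, z). kern x z * w z) \<in> borel_measurable (half_line \<Otimes>\<^sub>M half_line)"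
    unfolding kern_def case_prod_beta by measurable
  then show ?thesis
    by (rule half_line.borel_measurable_lebesgue_integral)
qed

lemma T_meas_funs:
  assumes f: "f \<in> meas_funs" shows "T f \<in> meas_funs"
proof -
  have "(\<lambda>x. LINT z|half_line. kern x z * D z (f z)) \<in> borel_measurable half_line"
    by (rule kern_integral_measurable[OF D_half_line[OF meas_funsD(1)[OF f]]])
  then have "(\<lambda>x. 1 - (LINT z|half_line. kern x z * D z (f z))) \<in> borel_measurable half_line"
    by simp
  then have "T f \<in> borel_measurable half_line"
    by (subst measurable_cong[where g = "\<lambda>x. 1 - (LINT z|half_line. kern x z * D z (f z))"])
      (auto simp: T_eq[OF f])
  moreover have "T f \<in> extensional {0..}" by (simp add: T_op_def)
  ultimately show ?thesis using T_bounds[OF f] by (simp add: meas_funs_def PiE_def)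
qed

lemma T_pow_meas_funs: "f \<in> meas_funs \<Longrightarrow> (T ^^ l) f \<in> meas_funs"
  by (induction l) (simp_all add: T_meas_funs)

lemma T_mono:
  assumes f: "f \<in> meas_funs" and g: "g \<in> meas_funs" and le: "\<And>z. z \<ge> 0 \<Longrightarrow> f z \<le> g z" and x: "x \<ge> 0"
  shows "T f x \<le> T g x"
proof -
  have "(LINT z|half_line. kern x z * D z (g z)) \<le> (LINT z|half_line. kern x z * D z (f z))"
  proof (rule half_line_integral_mono[OF integrable_kern_D[OF g x] integrable_kern_D[OF f x]])
    fix z :: real assume z: "z \<ge> 0"
    have "D z (g z) \<le> D z (f z)"
      by (rule D_antimono[OF z meas_funsD(2)[OF f z] le[OF z] meas_funsD(3)[OF g z]])
    then show "kern x z * D z (g z) \<le> kern x z * D z (f z)"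
      by (rule mult_left_mono[OF _ kern_nonneg[OF x z]])
  qed
  then show ?thesis by (simp add: T_eq[OF f x] T_eq[OF g x])
qed

lemma T_pow_mono:
  assumes f: "f \<in> meas_funs" and g: "g \<in> meas_funs" and le: "\<And>z. z \<ge> 0 \<Longrightarrow> f z \<le> g z" and x: "x \<ge> 0"
  shows "(T ^^ l) f x \<le> (T ^^ l) g x"
  using x
proof (induction l arbitrary: x)
  case (Suc l)
  then show ?case using T_mono[OF T_pow_meas_funs[OF f] T_pow_meas_funs[OF g]] by simp
qed (simp add: le)

lemma T_cong_AE:
  assumes f: "f \<in> meas_funs" and g: "g \<in> meas_funs" and eq: "AE z in half_line. f z = g z"
  shows "T f = T g"
proof
  fix x
  show "T f x = T g x"
  proof (cases "x \<ge> 0")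
    case True
    have "(LINT z|half_line. kern x z * D z (f z)) = (LINT z|half_line. kern x z * D z (g z))"
      using eq by (intro integral_cong_AE kern_D_measurable meas_funsD(1) f g) auto
    then show ?thesis by (simp add: T_eq[OF f True] T_eq[OF g True])
  qed (simp add: T_op_def)
qed

text \<open>Termwise |a^k - b^k| \<le> k |a - b|, and the weights k sum to z \<open>g2\<close> by
  \<open>S_terms_sums\<close>.\<close>

lemma D_lipschitz:
  assumes z: "z \<ge> 0" and a: "0 \<le> a" "a \<le> 1" and b: "0 \<le> b" "b \<le> 1"
  shows "\<bar>D z a - D z b\<bar> \<le> \<bar>a - b\<bar> * (z * g2 P z)"
proof -
  have "D z a - D z b = (\<Sum>k. p k * gamma_dens k z * (1 - a ^ k) - p k * gamma_dens k z * (1 - b ^ k))"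
    unfolding D_def by (rule suminf_diff[OF D_summable[OF z a] D_summable[OF z b]])
  also have "norm \<dots> \<le> (\<Sum>k. \<bar>a - b\<bar> * (p k * gamma_dens k z * real k))"
  proof (rule norm_suminf_le)
    show "summable (\<lambda>k. \<bar>a - b\<bar> * (p k * gamma_dens k z * real k))"
      by (rule summable_mult[OF sums_summable[OF S_terms_sums[OF z]]])
    fix k
    have "\<bar>a ^ k - b ^ k\<bar> \<le> real k * \<bar>a - b\<bar>"
      using norm_power_diff[of a b k] a b by simp
    then have "p k * gamma_dens k z * \<bar>a ^ k - b ^ k\<bar> \<le> p k * gamma_dens k z * (real k * \<bar>a - b\<bar>)"
      by (rule mult_left_mono) (intro mult_nonneg_nonneg p_nonneg gamma_dens_nonneg z)
    moreover have "p k * gamma_dens k z * (1 - a ^ k) - p k * gamma_dens k z * (1 - b ^ k)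
        = - (p k * gamma_dens k z * (a ^ k - b ^ k))" by (simp add: algebra_simps)
    ultimately show "norm (p k * gamma_dens k z * (1 - a ^ k) - p k * gamma_dens k z * (1 - b ^ k))
        \<le> \<bar>a - b\<bar> * (p k * gamma_dens k z * real k)"
      using p_nonneg[of k] gamma_dens_nonneg[OF z, of k] by (simp add: abs_mult mult_ac)
  qed
  also have "\<dots> = \<bar>a - b\<bar> * (z * g2 P z)"
    by (rule sums_unique[symmetric, OF sums_mult[OF S_terms_sums[OF z]]])
  finally show ?thesis by simp
qed

lemma D_tendsto:
  assumes z: "z \<ge> 0" and a: "\<And>l. 0 \<le> a l" "\<And>l. a l \<le> 1" and lim: "a \<longlonglongrightarrow> b"
  shows "(\<lambda>l. D z (a l)) \<longlonglongrightarrow> D z b"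
proof -
  have b: "0 \<le> b" "b \<le> 1"
    using LIMSEQ_le_const[OF lim] LIMSEQ_le_const2[OF lim] a by blast+
  have "(\<lambda>l. \<bar>a l - b\<bar> * (z * g2 P z)) \<longlonglongrightarrow> \<bar>b - b\<bar> * (z * g2 P z)"
    by (intro tendsto_intros lim)
  then have 0: "(\<lambda>l. \<bar>a l - b\<bar> * (z * g2 P z)) \<longlonglongrightarrow> 0" by simp
  have "(\<lambda>l. D z (a l) - D z b) \<longlonglongrightarrow> 0"
    by (rule Lim_null_comparison[OF always_eventually 0]) (use D_lipschitz[OF z a b] in simp)
  then show ?thesis by (rule LIM_zero_cancel)
qed

lemma T_tendsto:
  assumes f: "\<And>l. f l \<in> meas_funs" and g: "g \<in> meas_funs"
    and lim: "\<And>z. z \<ge> 0 \<Longrightarrow> (\<lambda>l. f l z) \<longlonglongrightarrow> g z" and x: "x \<ge> 0"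
  shows "(\<lambda>l. T (f l) x) \<longlonglongrightarrow> T g x"
proof -
  have "(\<lambda>l. LINT z|half_line. kern x z * D z (f l z)) \<longlonglongrightarrow> (LINT z|half_line. kern x z * D z (g z))"
  proof (rule integral_dominated_convergence)
    show "(\<lambda>z. kern x z * D z (g z)) \<in> borel_measurable half_line"
      by (rule kern_D_measurable[OF meas_funsD(1)[OF g]])
    show "(\<lambda>z. kern x z * D z (f l z)) \<in> borel_measurable half_line" for l
      by (rule kern_D_measurable[OF meas_funsD(1)[OF f]])
    show "integrable half_line (\<lambda>z. D z 0)" by (rule integrable_D0)
    show "AE z in half_line. (\<lambda>l. kern x z * D z (f l z)) \<longlonglongrightarrow> kern x z * D z (g z)"
    proof (rule AE_half_line_cong)
      fix z :: real assume z: "z \<ge> 0"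
      have "(\<lambda>l. D z (f l z)) \<longlonglongrightarrow> D z (g z)"
        by (rule D_tendsto[OF z meas_funsD(2)[OF f z] meas_funsD(3)[OF f z] lim[OF z]])
      then show "(\<lambda>l. kern x z * D z (f l z)) \<longlonglongrightarrow> kern x z * D z (g z)"
        by (rule tendsto_mult_left)
    qed
    show "AE z in half_line. norm (kern x z * D z (f l z)) \<le> D z 0" for l
      by (rule AE_half_line_cong) (use kern_D_bounds[OF f x] in simp)
  qed
  then have "(\<lambda>l. 1 - (LINT z|half_line. kern x z * D z (f l z)))
      \<longlonglongrightarrow> 1 - (LINT z|half_line. kern x z * D z (g z))"
    by (intro tendsto_diff tendsto_const)
  then show ?thesis by (simp only: T_eq[OF f x] T_eq[OF g x])
qed

section \<open>Limits of monotone iterations and the smallest fixed point\<close>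

lemma meas_funs_lim:
  assumes f: "\<And>l. f l \<in> meas_funs" and lim: "\<And>z. z \<ge> 0 \<Longrightarrow> (\<lambda>l. f l z) \<longlonglongrightarrow> g z"
    and ext: "g \<in> extensional {0..}"
  shows "g \<in> meas_funs"
proof -
  have "g \<in> borel_measurable half_line"
    by (rule borel_measurable_LIMSEQ_real[OF lim meas_funsD(1)[OF f]]) simp
  moreover have "0 \<le> g z" if "z \<ge> 0" for z
    using LIMSEQ_le_const[OF lim[OF that]] meas_funsD(2)[OF f that] by blast
  moreover have "g z \<le> 1" if "z \<ge> 0" for z
    using LIMSEQ_le_const2[OF lim[OF that]] meas_funsD(3)[OF f that] by blast
  ultimately show ?thesis using ext by (simp add: meas_funs_def PiE_def Pi_def)
qed

text \<open>Bounded monotone iterates converge, and \<open>T_tendsto\<close> lets the limit pass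
  through the operator. This serves both the increasing iteration from 0 and the decreasing one from
  a supersolution.\<close>

lemma T_pow_monotone_limit:
  assumes f: "f \<in> meas_funs" and mono: "\<And>x. x \<ge> 0 \<Longrightarrow> monoseq (\<lambda>l. (T ^^ l) f x)"
  shows "\<exists>v\<in>fixed_points P. \<forall>x\<ge>0. (\<lambda>l. (T ^^ l) f x) \<longlonglongrightarrow> v x"
proof -
  define v where "v = (\<lambda>x\<in>{0..}. lim (\<lambda>l. (T ^^ l) f x))"
  have lim: "(\<lambda>l. (T ^^ l) f x) \<longlonglongrightarrow> v x" if x: "x \<ge> 0" for x
  proof -
    have "Bseq (\<lambda>l. (T ^^ l) f x)"
      by (rule BseqI'[of _ 1]) (use meas_funsD(2,3)[OF T_pow_meas_funs[OF f] x] in simp)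
    then have "convergent (\<lambda>l. (T ^^ l) f x)"
      using mono[OF x] by (rule Bseq_monoseq_convergent)
    then show ?thesis using x by (simp add: v_def convergent_LIMSEQ_iff)
  qed
  have v: "v \<in> meas_funs"
    by (rule meas_funs_lim[OF T_pow_meas_funs[OF f] lim]) (unfold v_def, simp_all only: restrict_extensional)
  have "T v x = v x" for x
  proof (cases "x \<ge> 0")
    case True
    have "(\<lambda>l. T ((T ^^ l) f) x) \<longlonglongrightarrow> T v x"
      by (rule T_tendsto[OF T_pow_meas_funs[OF f] v lim True])
    moreover have "(\<lambda>l. (T ^^ Suc l) f x) \<longlonglongrightarrow> v x"
      using lim[OF True] by (rule LIMSEQ_Suc)
    ultimately show ?thesis using LIMSEQ_unique by fastforce
  qed (simp add: T_op_def v_def)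
  then have "v \<in> fixed_points P" using v by (auto simp: fixed_points_def)
  then show ?thesis using lim by blast
qed

lemma T_pow_fixed: "f \<in> fixed_points P \<Longrightarrow> (T ^^ l) f = f"
  by (induction l) (auto simp: fixed_points_def)

lemma smallest_fixed_point_props:
  shows "smallest_fixed_point P \<in> fixed_points P"
    and "f \<in> fixed_points P \<Longrightarrow> x \<ge> 0 \<Longrightarrow> smallest_fixed_point P x \<le> f x"
    and "x \<ge> 0 \<Longrightarrow> (\<lambda>l. (T ^^ l) (\<lambda>x\<in>{0..}. 0) x) \<longlonglongrightarrow> smallest_fixed_point P x"
proof -
  let ?z = "\<lambda>x\<in>{0::real..}. 0 :: real"
  have z: "?z \<in> meas_funs" by (rule const_meas_funs) auto
  have "incseq (\<lambda>l. (T ^^ l) ?z x)" if "x \<ge> 0" for x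
  proof (rule incseq_SucI)
    fix l
    have "(T ^^ l) ?z x \<le> (T ^^ l) (T ?z) x"
      using that meas_funsD(2)[OF T_meas_funs[OF z]] by (intro T_pow_mono z T_meas_funs) auto
    then show "(T ^^ l) ?z x \<le> (T ^^ Suc l) ?z x" by (simp add: funpow_swap1)
  qed
  then have "monoseq (\<lambda>l. (T ^^ l) ?z x)" if "x \<ge> 0" for x
    using that by (simp add: monoseq_iff)
  from T_pow_monotone_limit[OF z this]
  obtain q where q: "q \<in> fixed_points P" and lim: "\<forall>x\<ge>0. (\<lambda>l. (T ^^ l) ?z x) \<longlonglongrightarrow> q x" ..
  have le: "q x \<le> f x" if f: "f \<in> fixed_points P" and x: "x \<ge> 0" for f x
  proof (rule LIMSEQ_le_const2[OF lim[rule_format, OF x]], intro exI allI impI)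
    fix l :: nat
    have "f \<in> meas_funs" using f by (simp add: fixed_points_def)
    then have "(T ^^ l) ?z x \<le> (T ^^ l) f x"
      using x by (intro T_pow_mono z) (auto dest: meas_funsD(2))
    then show "(T ^^ l) ?z x \<le> f x" by (simp only: T_pow_fixed[OF f])
  qed
  have "smallest_fixed_point P = q"
    unfolding smallest_fixed_point_def
  proof (rule the_equality)
    show "q \<in> fixed_points P \<and> (\<forall>f\<in>fixed_points P. \<forall>x\<ge>0. q x \<le> f x)" using q le by blast
    fix r assume r: "r \<in> fixed_points P \<and> (\<forall>f\<in>fixed_points P. \<forall>x\<ge>0. r x \<le> f x)"
    \<comment> \<open>Two least fixed points agree on the half-line; off it both are the default
      value of extensional functions.\<close>
    show "r = q"
    proof (rule extensionalityI[of _ "{0..}"])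
      show "r \<in> extensional {0..}" "q \<in> extensional {0..}"
        using r q by (auto simp: fixed_points_def dest: meas_funsD(4))
      show "r x = q x" if "x \<in> {0..}" for x
        using r q le that by (intro antisym) auto
    qed
  qed
  then show "smallest_fixed_point P \<in> fixed_points P"
    "f \<in> fixed_points P \<Longrightarrow> x \<ge> 0 \<Longrightarrow> smallest_fixed_point P x \<le> f x"
    "x \<ge> 0 \<Longrightarrow> (\<lambda>l. (T ^^ l) ?z x) \<longlonglongrightarrow> smallest_fixed_point P x"
    using q lim le by auto
qed

lemma D_1: "D z 1 = 0"
  by (simp add: D_def)

lemma one_fixed_point: "(\<lambda>x\<in>{0..}. 1) \<in> fixed_points P"
proof -
  let ?o = "\<lambda>x\<in>{0::real..}. 1 :: real"
  have o: "?o \<in> meas_funs" by (rule const_meas_funs) auto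
  have "T ?o x = ?o x" for x
  proof (cases "x \<ge> 0")
    case True
    have "(LINT z|half_line. kern x z * D z (?o z)) = (LINT z|half_line. 0)"
      by (rule half_line_integral_cong) (simp add: D_1)
    then show ?thesis using True by (simp add: T_eq[OF o True])
  qed (simp add: T_op_def)
  then show ?thesis using o by (auto simp: fixed_points_def)
qed

end


subsection \<open>Uniqueness of the nontrivial fixed point\<close>

text \<open>Fubini for the symmetric kernel. Bounding min(x,z) by x puts the whole weight on u,
  which is why u needs a first moment while w need only be integrable.\<close>

lemma min_kernel_symmetric:
  fixes u w :: "real \<Rightarrow> real"
  assumes u [measurable]: "u \<in> borel_measurable half_line" and w [measurable]: "w \<in> borel_measurable half_line"
    and u0: "\<And>z. z \<ge> 0 \<Longrightarrow> 0 \<le> u z" and w0: "\<And>z. z \<ge> 0 \<Longrightarrow> 0 \<le> w z"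
    and xu: "integrable half_line (\<lambda>z. z * u z)" and iw: "integrable half_line w"
  shows "(LINT x|half_line. u x * (LINT z|half_line. min x z * w z))
    = (LINT z|half_line. w z * (LINT x|half_line. min z x * u x))"
proof -
  let ?f = "\<lambda>(x, z). u x * (min x z * w z)"
  have fm: "?f \<in> borel_measurable (half_line \<Otimes>\<^sub>M half_line)"
  proof -
    have [measurable]: "(\<lambda>v. u (fst v)) \<in> borel_measurable (half_line \<Otimes>\<^sub>M half_line)"
      by (rule measurable_compose[OF measurable_fst u])
    have [measurable]: "(\<lambda>v. w (snd v)) \<in> borel_measurable (half_line \<Otimes>\<^sub>M half_line)"
      by (rule measurable_compose[OF measurable_snd w])
    show ?thesis unfolding case_prod_beta by measurable
  qed
  have minm: "min x \<in> borel_measurable half_line" for x :: real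
    by (rule borel_measurable_half_line) measurable
  have inner: "integrable half_line (\<lambda>z. min x z * w z)"
    and inner_le: "(LINT z|half_line. min x z * w z) \<le> x * integral\<^sup>L half_line w"
    and inner_ge: "0 \<le> (LINT z|half_line. min x z * w z)" if x: "x \<ge> 0" for x
  proof -
    have b: "0 \<le> min x z * w z" "min x z * w z \<le> x * w z" if "z \<ge> 0" for z
      using x that w0[OF that] by (auto intro: mult_right_mono)
    show i: "integrable half_line (\<lambda>z. min x z * w z)"
      by (rule integrable_half_line_bound[OF integrable_mult_right[OF iw, of x] borel_measurable_times[OF minm w]])
        (use b in simp)
    show "(LINT z|half_line. min x z * w z) \<le> x * integral\<^sup>L half_line w"
      using half_line_integral_mono[OF i integrable_mult_right[OF iw] b(2)] by simp
    show "0 \<le> (LINT z|half_line. min x z * w z)"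
      by (rule half_line_integral_nonneg[OF b(1)])
  qed
  have norm_inner: "(LINT z|half_line. norm (?f (x, z))) = u x * (LINT z|half_line. min x z * w z)"
    if x: "x \<ge> 0" for x
  proof -
    have "(LINT z|half_line. norm (?f (x, z))) = (LINT z|half_line. u x * (min x z * w z))"
      using x u0[OF x] w0 by (intro half_line_integral_cong) (simp add: abs_mult)
    then show ?thesis by simp
  qed
  have "integrable (half_line \<Otimes>\<^sub>M half_line) ?f"
  proof (rule half_plane.Fubini_integrable[OF fm])
    have "(\<lambda>x. LINT z|half_line. norm (?f (x, z))) \<in> borel_measurable half_line"
      using fm by (intro half_line.borel_measurable_lebesgue_integral) simp
    then show "integrable half_line (\<lambda>x. LINT z|half_line. norm (?f (x, z)))"
    proof (rule integrable_half_line_bound[OF integrable_mult_left[OF xu, of "integral\<^sup>L half_line w"]])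
      fix x :: real assume x: "x \<ge> 0"
      have "u x * (LINT z|half_line. min x z * w z) \<le> u x * (x * integral\<^sup>L half_line w)"
        by (rule mult_left_mono[OF inner_le[OF x] u0[OF x]])
      moreover have "0 \<le> u x * (LINT z|half_line. min x z * w z)"
        by (rule mult_nonneg_nonneg[OF u0[OF x] inner_ge[OF x]])
      ultimately show "\<bar>LINT z|half_line. norm (?f (x, z))\<bar> \<le> x * u x * integral\<^sup>L half_line w"
        unfolding norm_inner[OF x] by (simp add: mult_ac)
    qed
    show "AE x in half_line. integrable half_line (\<lambda>z. ?f (x, z))"
      using inner by (intro AE_half_line_cong) simp
  qed
  then have "(LINT z|half_line. (LINT x|half_line. u x * (min x z * w z)))
      = (LINT x|half_line. (LINT z|half_line. u x * (min x z * w z)))"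
    by (intro half_plane.Fubini_integral) simp
  moreover have "(LINT x|half_line. u x * (min x z * w z)) = w z * (LINT x|half_line. min z x * u x)" for z
  proof -
    have "(LINT x|half_line. u x * (min x z * w z)) = (LINT x|half_line. w z * (min z x * u x))"
      by (simp add: mult_ac min.commute)
    then show ?thesis by simp
  qed
  ultimately show ?thesis by simp
qed

lemma kern_pos: "x \<ge> 0 \<Longrightarrow> z > 0 \<Longrightarrow> 0 < kern x z"
  by (simp add: kern_def)

text \<open>With \<open>kern_lower\<close>, this separates the variables: up to factors depending on
  z alone, the kernel has the profile \<open>kern x 1\<close> in x.\<close>

lemma kern_upper:
  assumes "x \<ge> 0" "z \<ge> 0" shows "kern x z \<le> kern x 1 * (1 + z)"
proof (cases "x \<le> 1")
  case True
  then show ?thesis using kern_le_1[OF assms] assms(2) by (simp add: kern_def)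
next
  case False
  then show ?thesis using assms by (auto simp: kern_def field_simps)
qed

lemma kern_lower:
  assumes "x \<ge> 0" "z \<ge> 0" shows "kern x 1 * min 1 z \<le> kern x z"
  using assms by (auto simp: kern_def min_def field_simps intro: mult_left_le_one_le)

lemma AE_half_line_pos: "AE z in half_line. (0::real) < z"
proof -
  have "AE z in half_line. (0::real) \<le> z" by (rule AE_half_line_cong)
  with AE_half_line_neq[of 0] show ?thesis by eventually_elim simp
qed

context offspring
begin

lemma D_pos:
  assumes "z > 0" "0 \<le> a" "a < 1" shows "0 < D z a"
proof -
  obtain k where k: "p (Suc k) > 0" using ex_p_Suc_pos by blast
  have "a ^ Suc k < 1" using power_Suc_le_self[of a k] assms by simp
  then have "0 < p (Suc k) * gamma_dens (Suc k) z * (1 - a ^ Suc k)"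
    using k gamma_dens_pos[OF assms(1)] by simp
  also have "\<dots> \<le> D z a"
    unfolding D_def using sum_le_suminf[OF D_summable[of z a], of "{Suc k}"] assms p_nonneg
      gamma_dens_nonneg[of z] one_minus_power_nonneg[of a]
    by simp
  finally show ?thesis .
qed

lemma S_strict_mono:
  assumes k: "2 \<le> k" "p k > 0" and z: "z > 0" and a: "0 \<le> a" "a < b" "b \<le> 1"
  shows "S z a < S z b"
proof -
  let ?d = "\<lambda>k. p k * gamma_dens k z * (\<Sum>j<k. b ^ j) - p k * gamma_dens k z * (\<Sum>j<k. a ^ j)"
  have s: "summable (\<lambda>k. p k * gamma_dens k z * (\<Sum>j<k. a ^ j))"
    "summable (\<lambda>k. p k * gamma_dens k z * (\<Sum>j<k. b ^ j))"
    using z a by (auto intro!: S_summable)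
  have d: "?d k = p k * gamma_dens k z * (\<Sum>j<k. b ^ j - a ^ j)" for k
    by (simp add: right_diff_distrib sum_subtractf)
  have ba: "0 \<le> b ^ j - a ^ j" for j using a by (simp add: power_mono)
  \<comment> \<open>The summand j = 1 is the first that depends on its base, and it occurs only if k
    \<ge> 2.\<close>
  have "0 < b ^ 1 - a ^ 1" using a by simp
  also have "\<dots> \<le> (\<Sum>j<k. b ^ j - a ^ j)"
    by (rule member_le_sum) (use k ba in auto)
  finally have "0 < ?d k" unfolding d using k gamma_dens_pos[OF z] by simp
  also have "?d k = sum ?d {k}" by simp
  also have "\<dots> \<le> suminf ?d"
  proof (rule sum_le_suminf)
    show "summable ?d" by (rule summable_diff[OF s(2,1)])
    show "0 \<le> ?d n" for n
      unfolding d using z by (intro mult_nonneg_nonneg p_nonneg gamma_dens_nonneg sum_nonneg ba) auto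
  qed auto
  also have "suminf ?d = S z b - S z a"
    unfolding S_def by (rule suminf_diff[symmetric, OF s(2,1)])
  finally show ?thesis by simp
qed

lemma T_less_1:
  assumes f: "f \<in> meas_funs" and D: "\<not> (AE z in half_line. D z (f z) = 0)" and x: "x \<ge> 0"
  shows "T f x < 1"
proof (rule ccontr)
  assume "\<not> T f x < 1"
  then have "(LINT z|half_line. kern x z * D z (f z)) = 0"
    using T_bounds(2)[OF f x] by (simp add: T_eq[OF f x])
  moreover have "AE z in half_line. 0 \<le> kern x z * D z (f z)"
    by (rule AE_half_line_cong) (rule kern_D_bounds(1)[OF f x])
  ultimately have "AE z in half_line. kern x z * D z (f z) = 0"
    using integral_nonneg_eq_0_iff_AE[OF integrable_kern_D[OF f x]] by blast
  with AE_half_line_pos have "AE z in half_line. D z (f z) = 0"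
    by eventually_elim (use kern_pos[OF x] in force)
  with D show False ..
qed

text \<open>If \<open>D z (f z)\<close> vanished almost everywhere, T f would be identically 1.
  Otherwise positivity of the kernel pushes T f below 1 at every point at once.\<close>

lemma fixed_point_less_1:
  assumes f: "f \<in> fixed_points P" "f \<noteq> (\<lambda>x\<in>{0..}. 1)" and x: "x \<ge> 0"
  shows "f x < 1"
proof -
  have fm: "f \<in> meas_funs" and Tf: "T f = f" using f by (auto simp: fixed_points_def)
  have "\<not> (AE z in half_line. D z (f z) = 0)"
  proof
    assume AE: "AE z in half_line. D z (f z) = 0"
    have "f y = (\<lambda>x\<in>{0..}. 1) y" for y
    proof (cases "y \<ge> 0")
      case True
      have "(LINT z|half_line. kern y z * D z (f z)) = 0"
        by (rule integral_eq_zero_AE) (use AE in eventually_elim, simp)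
      then have "T f y = 1" by (simp add: T_eq[OF fm True])
      then show ?thesis using True Tf by simp
    next
      case False
      then show ?thesis using meas_funsD(4)[OF fm] by (simp add: extensional_def)
    qed
    with f(2) show False by auto
  qed
  from T_less_1[OF fm this x] Tf show ?thesis by simp
qed

lemma fixed_point_min_kernel:
  assumes f: "f \<in> fixed_points P" and x: "x \<ge> 0"
  shows "(LINT z|half_line. min x z * D z (f z)) = x * (1 - f x)"
proof -
  have fm: "f \<in> meas_funs" and Tf: "T f = f" using f by (auto simp: fixed_points_def)
  have "(LINT z|half_line. min x z * D z (f z)) = (LINT z|half_line. x * (kern x z * D z (f z)))"
    by (rule half_line_integral_cong) (simp only: mult.assoc[symmetric] kern_mult[OF x])
  also have "\<dots> = x * (1 - T f x)" by (simp add: T_eq[OF fm x])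
  finally show ?thesis by (simp add: Tf)
qed

lemma D_fun_props:
  assumes f: "f \<in> meas_funs"
  shows "(\<lambda>z. D z (f z)) \<in> borel_measurable half_line"
    and "z \<ge> 0 \<Longrightarrow> 0 \<le> D z (f z)"
    and "z \<ge> 0 \<Longrightarrow> D z (f z) \<le> D z 0"
    and "integrable half_line (\<lambda>z. D z (f z))"
    and "integrable half_line (\<lambda>z. z * D z (f z))"
proof -
  show m: "(\<lambda>z. D z (f z)) \<in> borel_measurable half_line"
    by (rule D_half_line[OF meas_funsD(1)[OF f]])
  show b: "0 \<le> D z (f z)" "D z (f z) \<le> D z 0" if "z \<ge> 0" for z
    using D_nonneg[OF that meas_funsD(2,3)[OF f that]]
      D_antimono[OF that order.refl meas_funsD(2,3)[OF f that]] .
  show "integrable half_line (\<lambda>z. D z (f z))"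
    by (rule integrable_half_line_bound[OF integrable_D0 m]) (use b in simp)
  have "integrable half_line (\<lambda>z. z * D z 0)" using integrable_power_D0[of 1] by simp
  then show "integrable half_line (\<lambda>z. z * D z (f z))"
  proof (rule integrable_half_line_bound)
    show "(\<lambda>z. z * D z (f z)) \<in> borel_measurable half_line"
      by (rule borel_measurable_times[OF ident_half_line m])
    show "\<bar>z * D z (f z)\<bar> \<le> z * D z 0" if "z \<ge> 0" for z
      using mult_left_mono[OF b(2)[OF that] that]
      by (simp only: abs_of_nonneg[OF mult_nonneg_nonneg[OF that b(1)[OF that]]])
  qed
qed

lemma fixed_point_unique:
  assumes k: "2 \<le> k" "p k > 0" and f: "f \<in> fixed_points P" "f \<noteq> (\<lambda>x\<in>{0..}. 1)"
  shows "f = smallest_fixed_point P"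
proof -
  let ?q = "smallest_fixed_point P"
  note q = smallest_fixed_point_props(1)
  have fm: "f \<in> meas_funs" and qm: "?q \<in> meas_funs" and Tf: "T f = f" and Tq: "T ?q = ?q"
    using f q by (auto simp: fixed_points_def)
  have le: "?q z \<le> f z" if "z \<ge> 0" for z by (rule smallest_fixed_point_props(2)[OF f(1) that])
  let ?I = "\<lambda>z. z * (1 - f z) * D z (?q z)"
  let ?J = "\<lambda>z. z * (1 - ?q z) * D z (f z)"
  \<comment> \<open>Both inner integrals are known from the fixed point equations, namely x(1 -
    f(x)) and z(1 - q(z)), so symmetry becomes an identity between single integrals.\<close>
  have "(LINT x|half_line. D x (?q x) * (LINT z|half_line. min x z * D z (f z)))
    = (LINT z|half_line. D z (f z) * (LINT x|half_line. min z x * D x (?q x)))"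
    by (rule min_kernel_symmetric)
      (rule D_fun_props[OF fm] D_fun_props[OF qm] | assumption)+
  moreover have "(LINT x|half_line. D x (?q x) * (LINT z|half_line. min x z * D z (f z)))
      = integral\<^sup>L half_line ?I"
    by (rule half_line_integral_cong) (simp add: fixed_point_min_kernel[OF f(1)])
  moreover have "(LINT z|half_line. D z (f z) * (LINT x|half_line. min z x * D x (?q x)))
      = integral\<^sup>L half_line ?J"
    by (rule half_line_integral_cong) (simp add: fixed_point_min_kernel[OF q])
  ultimately have eq: "integral\<^sup>L half_line ?I = integral\<^sup>L half_line ?J" by simp
  have int: "integrable half_line (\<lambda>z. z * (1 - g z) * D z (h z))"
    if g: "g \<in> meas_funs" and h: "h \<in> meas_funs" for g h
  proof (rule integrable_half_line_bound[OF D_fun_props(5)[OF h]])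
    show "(\<lambda>z. z * (1 - g z) * D z (h z)) \<in> borel_measurable half_line"
      using meas_funsD(1)[OF g] D_fun_props(1)[OF h] ident_half_line by simp
    fix z :: real assume z: "z \<ge> 0"
    have "(1 - g z) * (z * D z (h z)) \<le> z * D z (h z)" "0 \<le> (1 - g z) * (z * D z (h z))"
      using meas_funsD(2,3)[OF g z] D_fun_props(2)[OF h z] z
      by (auto intro!: mult_left_le_one_le)
    then show "\<bar>z * (1 - g z) * D z (h z)\<bar> \<le> z * D z (h z)" by (simp add: mult_ac)
  qed
  \<comment> \<open>Comparing with the smallest fixed point, instead of with an arbitrary one,
    orders the two arguments of S and gives this difference a fixed sign.\<close>
  have diff: "?J z - ?I z = z * (1 - f z) * (1 - ?q z) * (S z (f z) - S z (?q z))" if "z \<ge> 0" for z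
    by (simp only: D_eq_S[OF that meas_funsD(2,3)[OF fm that]] D_eq_S[OF that meas_funsD(2,3)[OF qm that]])
      (simp add: algebra_simps)
  have "integral\<^sup>L half_line (\<lambda>z. ?J z - ?I z) = 0"
    using eq by (simp add: int fm qm)
  moreover have "AE z in half_line. 0 \<le> ?J z - ?I z"
  proof (rule AE_half_line_cong)
    fix z :: real assume z: "z \<ge> 0"
    have "S z (?q z) \<le> S z (f z)"
      by (rule S_mono[OF z meas_funsD(2)[OF qm z] le[OF z] meas_funsD(3)[OF fm z]])
    then show "0 \<le> ?J z - ?I z"
      unfolding diff[OF z] using z meas_funsD(3)[OF fm z] meas_funsD(3)[OF qm z]
      by (intro mult_nonneg_nonneg) auto
  qed
  ultimately have "AE z in half_line. ?J z - ?I z = 0"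
    using integral_nonneg_eq_0_iff_AE[OF Bochner_Integration.integrable_diff[OF int[OF qm fm] int[OF fm qm]]]
    by blast
  with AE_half_line_pos have "AE z in half_line. f z = ?q z"
  proof eventually_elim
    case (elim z)
    have f1: "f z < 1" using fixed_point_less_1[OF f] elim by simp
    then have q1: "?q z < 1" using le[of z] elim by simp
    then have eqS: "S z (f z) = S z (?q z)" using elim diff[of z] f1 by simp
    have z0: "0 \<le> z" using elim(1) by simp
    have "\<not> ?q z < f z"
      using S_strict_mono[OF k elim(1) meas_funsD(2)[OF qm z0] _ meas_funsD(3)[OF fm z0]] eqS by linarith
    then show ?case using le[of z] elim by simp
  qed
  \<comment> \<open>One application of T upgrades equality almost everywhere to equality
    everywhere.\<close>
  from T_cong_AE[OF fm qm this] Tf Tq show ?thesis by simp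
qed

text \<open>\<open>p k\<close> is P(k+1), so k \<ge> 2 means at least three offspring. This is the
  input that \<open>S_strict_mono\<close> requires.\<close>

lemma ex_p_ge_2_pos:
  assumes "beta0 P > 1"
  shows "\<exists>k\<ge>2. p k > 0"
proof (rule ccontr)
  assume no: "\<not> ?thesis"
  have p0: "p k = 0" if "2 \<le> k" for k
  proof -
    have "\<not> p k > 0" using no that by blast
    then show ?thesis using p_nonneg[of k] by simp
  qed
  obtain s \<phi> where e: "eigenpair s \<phi>" using eigenpair_exists by blast
  note s = eigenpairD(1,2)[OF e] and eig = eigenpairD(6)[OF e] and tot = eigenpairD(7)[OF e]
  \<comment> \<open>Now \<open>D\<close> is affine in its second argument, so that comparing \<open>T 0 \<ge> 0\<close> with the eigenfunction
    bounds the eigenvalue by \<open>1\<close>.\<close>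
  have D0: "D z 0 = z * g2 P z" if "z \<ge> 0" for z
  proof -
    have "p k * gamma_dens k z * real k = p k * gamma_dens k z * (1 - 0 ^ k)" for k
    proof (cases "k = 0 \<or> k = 1")
      case False
      then have "2 \<le> k" by auto
      then show ?thesis by (simp add: p0)
    qed auto
    then have "(\<lambda>k. p k * gamma_dens k z * (1 - 0 ^ k)) sums (z * g2 P z)"
      using S_terms_sums[OF that] by (simp only:)
    then show ?thesis
      unfolding D_def by (rule sums_unique[symmetric])
  qed
  let ?u = "\<lambda>z. g2 P z * \<phi> z"
  note um = eigenpair_weight(1)[OF e] and u0 = eigenpair_weight(2)[OF e]
    and zu = eigenpair_weight(4)[OF e]
  have tot': "(LINT z|half_line. z * ?u z) = 1 / s"
    using tot s(1) by (simp add: field_simps)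
  have D0m: "(\<lambda>z. D z 0) \<in> borel_measurable half_line"
    by (rule D_half_line) simp
  have D00: "0 \<le> D z 0" if "z \<ge> 0" for z
    using that by (rule D_nonneg) auto
  \<comment> \<open>By symmetry and the eigenvalue equation this pairing equals 1/s^2. Bounding
    min(x,z) by x and the integral of \<open>D z 0\<close> by 1 leaves at most 1/s, so 1/s \<le>
    1.\<close>
  have "(LINT x|half_line. ?u x * (LINT z|half_line. min x z * D z 0))
    = (LINT z|half_line. D z 0 * (LINT x|half_line. min z x * ?u x))"
    by (rule min_kernel_symmetric[OF um D0m u0 D00 zu integrable_D0])
  also have "\<dots> = (LINT z|half_line. (z * ?u z) / s)"
    by (rule half_line_integral_cong) (use eig s(1) in \<open>simp add: D0 field_simps\<close>)
  also have "\<dots> = 1 / s / s" by (simp add: tot')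
  finally have "1 / s / s = (LINT x|half_line. ?u x * (LINT z|half_line. min x z * D z 0))" by simp
  also have "\<dots> \<le> (LINT x|half_line. x * ?u x)"
  proof (rule integral_mono'[OF zu])
    fix x assume "x \<in> space half_line"
    then have x: "x \<ge> 0" by simp
    have "(LINT z|half_line. min x z * D z 0) \<le> (LINT z|half_line. x * D z 0)"
    proof (rule integral_mono'[OF integrable_mult_right[OF integrable_D0]])
      fix z assume "z \<in> space half_line"
      then have z: "D z 0 \<ge> 0" using D00 by simp
      show "min x z * D z 0 \<le> x * D z 0" using min.cobounded1 z by (rule mult_right_mono)
      show "0 \<le> x * D z 0" using x z by simp
    qed
    also have "\<dots> \<le> x" using x integral_D0_le_1 by (simp add: mult_left_le)
    finally have "?u x * (LINT z|half_line. min x z * D z 0) \<le> ?u x * x"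
      using u0[OF x] by (rule mult_left_mono)
    then show "?u x * (LINT z|half_line. min x z * D z 0) \<le> x * ?u x" by (simp only: mult.commute)
    show "0 \<le> x * ?u x" using x u0[OF x] by simp
  qed
  finally have "1 / s / s \<le> 1 / s" by (simp only: tot')
  then show False using assms s by (simp add: field_simps)
qed

section \<open>Supersolutions close to 1\<close>

lemma S_tendsto_1:
  assumes z: "z \<ge> 0" and a: "\<And>n. 0 \<le> a n" "\<And>n. a n \<le> 1" and lim: "a \<longlonglongrightarrow> 1"
  shows "(\<lambda>n. S z (a n)) \<longlonglongrightarrow> S z 1"
proof -
  have "eventually (\<lambda>n. summable (\<lambda>k. norm (p k * gamma_dens k z * (\<Sum>j<k. a n ^ j)))) sequentially \<and>
      summable (\<lambda>k. norm (p k * gamma_dens k z * (\<Sum>j<k. 1 ^ j))) \<and>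
      ((\<lambda>n. suminf (\<lambda>k. p k * gamma_dens k z * (\<Sum>j<k. a n ^ j))) \<longlonglongrightarrow>
        suminf (\<lambda>k. p k * gamma_dens k z * (\<Sum>j<k. 1 ^ j)))"
  proof (rule tannerys_theorem)
    show "(\<lambda>n. p k * gamma_dens k z * (\<Sum>j<k. a n ^ j)) \<longlonglongrightarrow> p k * gamma_dens k z * (\<Sum>j<k. 1 ^ j)" for k
      by (intro tendsto_intros lim)
    show "summable (\<lambda>k. p k * gamma_dens k z * real k)"
      by (rule sums_summable[OF S_terms_sums[OF z]])
    have "norm (p k * gamma_dens k z * (\<Sum>j<k. a n ^ j)) \<le> p k * gamma_dens k z * real k" for k n
    proof -
      have "(\<Sum>j<k. a n ^ j) \<le> (\<Sum>j<k. 1)" using a by (intro sum_mono power_le_one)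
      moreover have "0 \<le> (\<Sum>j<k. a n ^ j)" using a by (intro sum_nonneg) auto
      ultimately show ?thesis
        using p_nonneg[of k] gamma_dens_nonneg[OF z, of k] by (simp add: abs_mult mult_left_mono)
    qed
    then show "\<forall>\<^sub>F (k, n) in at_top \<times>\<^sub>F sequentially.
        norm (p k * gamma_dens k z * (\<Sum>j<k. a n ^ j)) \<le> p k * gamma_dens k z * real k"
      by (intro always_eventually) auto
  qed simp
  then show ?thesis by (simp only: S_def)
qed

lemma integrable_kern_mult:
  assumes w: "integrable half_line w" and x: "x \<ge> 0"
  shows "integrable half_line (\<lambda>z. kern x z * w z)"
proof (rule integrable_half_line_bound)
  show "integrable half_line (\<lambda>z. \<bar>w z\<bar>)" using w by simp
  show "(\<lambda>z. kern x z * w z) \<in> borel_measurable half_line"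
    by (rule borel_measurable_times[OF kern_half_line borel_measurable_integrable[OF w]])
  show "\<bar>kern x z * w z\<bar> \<le> \<bar>w z\<bar>" if "z \<ge> 0" for z
    using kern_nonneg[OF x that] kern_le_1[OF x that] by (simp add: abs_mult mult_left_le_one_le)
qed

lemma kern_integral_upper:
  assumes w: "integrable half_line w" and zw: "integrable half_line (\<lambda>z. z * w z)"
    and w0: "\<And>z. z \<ge> 0 \<Longrightarrow> 0 \<le> w z" and x: "x \<ge> 0"
  shows "(LINT z|half_line. kern x z * w z) \<le> kern x 1 * (LINT z|half_line. (1 + z) * w z)"
proof -
  have i: "integrable half_line (\<lambda>z. (1 + z) * w z)" using w zw by (simp add: distrib_right)
  have "(LINT z|half_line. kern x z * w z) \<le> (LINT z|half_line. kern x 1 * ((1 + z) * w z))"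
  proof (rule half_line_integral_mono[OF integrable_kern_mult[OF w x] integrable_mult_right[OF i]])
    show "kern x z * w z \<le> kern x 1 * ((1 + z) * w z)" if "z \<ge> 0" for z
      using mult_right_mono[OF kern_upper[OF x that] w0[OF that]] by (simp add: mult_ac)
  qed
  then show ?thesis by simp
qed

lemma kern_integral_lower:
  assumes w: "integrable half_line w" and w0: "\<And>z. z \<ge> 0 \<Longrightarrow> 0 \<le> w z" and x: "x \<ge> 0"
  shows "kern x 1 * (LINT z|half_line. min 1 z * w z) \<le> (LINT z|half_line. kern x z * w z)"
proof -
  have m: "min 1 \<in> borel_measurable half_line" by (rule borel_measurable_half_line) measurable
  have i: "integrable half_line (\<lambda>z. min 1 z * w z)"
  proof (rule integrable_half_line_bound[OF w])
    show "(\<lambda>z. min 1 z * w z) \<in> borel_measurable half_line"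
      by (rule borel_measurable_times[OF m borel_measurable_integrable[OF w]])
    show "\<bar>min 1 z * w z\<bar> \<le> w z" if "z \<ge> 0" for z
      using that w0[OF that] by (simp add: abs_mult mult_left_le_one_le)
  qed
  have "(LINT z|half_line. kern x 1 * (min 1 z * w z)) \<le> (LINT z|half_line. kern x z * w z)"
  proof (rule half_line_integral_mono[OF integrable_mult_right[OF i] integrable_kern_mult[OF w x]])
    show "kern x 1 * (min 1 z * w z) \<le> kern x z * w z" if "z \<ge> 0" for z
      using mult_right_mono[OF kern_lower[OF x that] w0[OF that]] by (simp add: mult_ac)
  qed
  then show ?thesis by simp
qed


text \<open>Here w = 1 - \<epsilon> \<rho> with \<epsilon> = 1/(n+1), and 1 - T w equals \<epsilon>
  times \<rho>/s minus an error. The error is at most \<open>kern x 1\<close> times an integral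
  tending to 0, whereas the surplus (1/s - 1) \<rho> is at least a fixed multiple of
  \<open>kern x 1\<close>.\<close>

lemma supersolutions_near_1:
  assumes beta: "beta0 P > 1"
  shows "\<exists>\<rho> C. (\<forall>x\<ge>0. 0 < \<rho> x \<and> \<rho> x \<le> C * kern x 1) \<and>
    (\<forall>\<^sub>F n in sequentially. (\<lambda>x\<in>{0..}. 1 - \<rho> x / real (Suc n)) \<in> meas_funs \<and>
      (\<forall>x\<ge>0. T (\<lambda>x\<in>{0..}. 1 - \<rho> x / real (Suc n)) x \<le> 1 - \<rho> x / real (Suc n)))"
proof -
  obtain s \<phi> where e: "eigenpair s \<phi>" using eigenpair_exists by blast
  note s = eigenpairD(1)[OF e] and \<phi>1 = eigenpairD(4)[OF e] and eig = eigenpairD(6)[OF e]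
  have s1: "s < 1" using beta s eigenpairD(2)[OF e] by simp
  let ?u = "\<lambda>z. g2 P z * \<phi> z"
  note um = eigenpair_weight(1)[OF e] and u0 = eigenpair_weight(2)[OF e]
    and iu = eigenpair_weight(3)[OF e] and zu = eigenpair_weight(4)[OF e]
  \<comment> \<open>This is \<phi>(x)/x for x > 0; writing it with \<open>kern\<close> supplies the
    value at 0.\<close>
  define \<rho> where "\<rho> x = s * (LINT z|half_line. kern x z * ?u z)" for x
  define C where "C = s * (LINT z|half_line. (1 + z) * ?u z)"
  have \<rho>_upper: "\<rho> x \<le> C * kern x 1" if "x \<ge> 0" for x
    using mult_left_mono[OF kern_integral_upper[OF iu zu u0 that], of s] s
    by (simp add: \<rho>_def C_def mult_ac)
  have \<rho>_lower: "\<phi> 1 * kern x 1 \<le> \<rho> x" if "x \<ge> 0" for x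
    using mult_left_mono[OF kern_integral_lower[OF iu u0 that], of s] s eig[of 1]
    by (simp add: \<rho>_def mult_ac)
  have \<rho>_pos: "0 < \<rho> x" if "x \<ge> 0" for x
    using \<rho>_lower[OF that] mult_pos_pos[OF \<phi>1 kern_pos[OF that zero_less_one]] by linarith
  have C0: "0 \<le> C"
  proof -
    have "0 \<le> (1 + z) * ?u z" if "z \<ge> 0" for z
      by (rule mult_nonneg_nonneg[OF _ u0[OF that]]) (use that in simp)
    then have "0 \<le> (LINT z|half_line. (1 + z) * ?u z)" by (rule half_line_integral_nonneg)
    then show ?thesis unfolding C_def using s by simp
  qed
  have \<rho>_C: "\<rho> x \<le> C" if "x \<ge> 0" for x
    using \<rho>_upper[OF that] mult_left_le[OF kern_le_1[OF that, of 1] C0] by simp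
  have \<rho>m: "\<rho> \<in> borel_measurable half_line"
    unfolding \<rho>_def[abs_def] using kern_integral_measurable[OF um] by simp
  have \<phi>_\<rho>: "\<phi> x = x * \<rho> x" if x: "x \<ge> 0" for x
  proof -
    have "(LINT z|half_line. min x z * ?u z) = (LINT z|half_line. x * (kern x z * ?u z))"
      by (rule half_line_integral_cong) (simp only: mult.assoc[symmetric] kern_mult[OF x])
    then show ?thesis using eig[OF x] by (simp add: \<rho>_def)
  qed
  \<comment> \<open>The linearization error of D at 1, divided by \<epsilon>.\<close>
  let ?R = "\<lambda>n z. \<rho> z * (S z 1 - S z (1 - \<rho> z / real (Suc n)))"
  let ?w = "\<lambda>n. \<lambda>x\<in>{0..}. 1 - \<rho> x / real (Suc n)"
  obtain n0 :: nat where n0: "C \<le> real n0" using real_arch_simple by blast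
  have w01: "0 \<le> 1 - \<rho> z / real (Suc n)" "1 - \<rho> z / real (Suc n) \<le> 1" if "n0 \<le> n" "z \<ge> 0" for n z
  proof -
    have "\<rho> z \<le> real (Suc n)" using \<rho>_C[OF that(2)] n0 that(1) by linarith
    then show "0 \<le> 1 - \<rho> z / real (Suc n)" by simp
    show "1 - \<rho> z / real (Suc n) \<le> 1" using \<rho>_pos[OF that(2)] by simp
  qed
  have wm: "(\<lambda>z. 1 - \<rho> z / real (Suc n)) \<in> borel_measurable half_line" for n
    using \<rho>m by measurable
  have w_meas: "?w n \<in> meas_funs" if "n0 \<le> n" for n
  proof -
    have "?w n \<in> borel_measurable half_line"
      by (subst measurable_cong[where g = "\<lambda>z. 1 - \<rho> z / real (Suc n)"]) (simp_all only: wm, simp)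
    then show ?thesis using w01[OF that] by (simp add: meas_funs_def del: of_nat_Suc)
  qed
  have Rm: "?R n \<in> borel_measurable half_line" for n
    by (intro borel_measurable_times borel_measurable_diff \<rho>m S_half_line wm) simp
  have S1: "0 \<le> \<rho> z * S z 1" "\<rho> z * S z 1 = ?u z" if z: "z \<ge> 0" for z
  proof -
    show "\<rho> z * S z 1 = ?u z" by (simp add: S_1[OF z] \<phi>_\<rho>[OF z] mult_ac)
    then show "0 \<le> \<rho> z * S z 1" using u0[OF z] by simp
  qed
  have R0: "0 \<le> ?R n z" and R_le: "?R n z \<le> ?u z" if n: "n0 \<le> n" and z: "z \<ge> 0" for n z
  proof -
    have "S z (1 - \<rho> z / real (Suc n)) \<le> S z 1" "0 \<le> S z (1 - \<rho> z / real (Suc n))"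
      using w01[OF n z] by (auto intro: S_mono S_nonneg z)
    moreover have "0 \<le> \<rho> z" using \<rho>_pos[OF z] by simp
    ultimately show "0 \<le> ?R n z" "?R n z \<le> ?u z"
      unfolding S1(2)[OF z, symmetric] by (auto intro!: mult_nonneg_nonneg mult_left_mono simp del: of_nat_Suc)
  qed
  have iR: "integrable half_line (?R n)" if n: "n0 \<le> n" for n
    by (rule integrable_half_line_bound[OF iu Rm]) (simp only: abs_of_nonneg[OF R0[OF n]] R_le[OF n])
  have zR: "integrable half_line (\<lambda>z. z * ?R n z)" if n: "n0 \<le> n" for n
  proof (rule integrable_half_line_bound[OF zu borel_measurable_times[OF ident_half_line Rm]])
    fix z :: real assume z: "z \<ge> 0"
    show "\<bar>z * ?R n z\<bar> \<le> z * ?u z"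
      unfolding abs_of_nonneg[OF mult_nonneg_nonneg[OF z R0[OF n z]]]
      by (rule mult_left_mono[OF R_le[OF n z] z])
  qed
  \<comment> \<open>The shift by n0 ensures that 1 - \<epsilon> \<rho> lies in [0,1], which the
    dominating function requires; \<open>LIMSEQ_offset\<close> removes it.\<close>
  have "(\<lambda>n. LINT z|half_line. (1 + z) * ?R (n + n0) z) \<longlonglongrightarrow> (LINT z|half_line. 0)"
  proof (rule integral_dominated_convergence)
    show "(\<lambda>z. (1 + z) * ?R (n + n0) z) \<in> borel_measurable half_line" for n
      by (rule borel_measurable_times[OF borel_measurable_add[OF borel_measurable_const ident_half_line] Rm])
    show "integrable half_line (\<lambda>z. (1 + z) * ?u z)"
      using iu zu by (simp add: distrib_right)
    show "AE z in half_line. (\<lambda>n. (1 + z) * ?R (n + n0) z) \<longlonglongrightarrow> 0"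
    proof (rule AE_half_line_cong)
      fix z :: real assume z: "z \<ge> 0"
      have "(\<lambda>n. 1 - \<rho> z / real (Suc n)) \<longlonglongrightarrow> 1 - 0"
        by (intro tendsto_diff tendsto_const) (rule LIMSEQ_Suc, rule lim_const_over_n)
      then have "(\<lambda>n. 1 - \<rho> z / real (Suc (n + n0))) \<longlonglongrightarrow> 1 - 0"
        by (rule LIMSEQ_ignore_initial_segment)
      then have "(\<lambda>n. S z (1 - \<rho> z / real (Suc (n + n0)))) \<longlonglongrightarrow> S z 1"
        by (intro S_tendsto_1[OF z] w01 z) (simp_all del: of_nat_Suc)
      then have "(\<lambda>n. (1 + z) * ?R (n + n0) z) \<longlonglongrightarrow> (1 + z) * (\<rho> z * (S z 1 - S z 1))"
        by (intro tendsto_mult tendsto_diff tendsto_const)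
      then show "(\<lambda>n. (1 + z) * ?R (n + n0) z) \<longlonglongrightarrow> 0" by simp
    qed
    fix n
    show "AE z in half_line. norm ((1 + z) * ?R (n + n0) z) \<le> (1 + z) * ?u z"
    proof (rule AE_half_line_cong)
      fix z :: real assume z: "z \<ge> 0"
      have n: "n0 \<le> n + n0" and z1: "0 \<le> 1 + z" using z by simp_all
      show "norm ((1 + z) * ?R (n + n0) z) \<le> (1 + z) * ?u z"
        unfolding real_norm_def abs_of_nonneg[OF mult_nonneg_nonneg[OF z1 R0[OF n z]]]
        by (rule mult_left_mono[OF R_le[OF n z] z1])
    qed
  qed simp
  then have "(\<lambda>n. LINT z|half_line. (1 + z) * ?R (n + n0) z) \<longlonglongrightarrow> 0" by simp
  then have "(\<lambda>n. LINT z|half_line. (1 + z) * ?R n z) \<longlonglongrightarrow> 0"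
    by (rule LIMSEQ_offset)
  moreover have gap: "0 < (1 / s - 1) * \<phi> 1" using s s1 \<phi>1 by simp
  ultimately have "\<forall>\<^sub>F n in sequentially. (LINT z|half_line. (1 + z) * ?R n z) < (1 / s - 1) * \<phi> 1"
    by (rule order_tendstoD(2))
  then have ev: "\<forall>\<^sub>F n in sequentially. ?w n \<in> meas_funs \<and> (\<forall>x\<ge>0. T (?w n) x \<le> 1 - \<rho> x / real (Suc n))"
    using eventually_ge_at_top[of n0]
  proof eventually_elim
    case (elim n)
    note n = elim(2)
    let ?\<epsilon> = "1 / real (Suc n)"
    have "T (?w n) x \<le> 1 - \<rho> x / real (Suc n)" if x: "x \<ge> 0" for x
    proof -
      have "(LINT z|half_line. kern x z * D z (?w n z))
          = (LINT z|half_line. ?\<epsilon> * (kern x z * ?u z - kern x z * ?R n z))"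
      proof (rule half_line_integral_cong)
        fix z :: real assume z: "z \<ge> 0"
        have "D z (?w n z) = (\<rho> z / real (Suc n)) * S z (1 - \<rho> z / real (Suc n))"
          using z by (simp add: D_eq_S[OF z w01[OF n z]] del: of_nat_Suc)
        also have "\<dots> = ?\<epsilon> * (\<rho> z * S z 1 - ?R n z)" by (simp add: algebra_simps del: of_nat_Suc)
        finally show "kern x z * D z (?w n z) = ?\<epsilon> * (kern x z * ?u z - kern x z * ?R n z)"
          unfolding S1(2)[OF z] by (simp only: right_diff_distrib mult.left_commute)
      qed
      also have "\<dots> = ?\<epsilon> * ((LINT z|half_line. kern x z * ?u z) - (LINT z|half_line. kern x z * ?R n z))"
        by (simp only: integral_mult_right_zero
            Bochner_Integration.integral_diff[OF integrable_kern_mult[OF iu x] integrable_kern_mult[OF iR[OF n] x]])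
      also have "(LINT z|half_line. kern x z * ?u z) = \<rho> x / s" using s by (simp add: \<rho>_def)
      finally have eq: "(LINT z|half_line. kern x z * D z (?w n z))
          = ?\<epsilon> * (\<rho> x / s - (LINT z|half_line. kern x z * ?R n z))" .
      have "(LINT z|half_line. kern x z * ?R n z) \<le> kern x 1 * (LINT z|half_line. (1 + z) * ?R n z)"
        by (rule kern_integral_upper[OF iR[OF n] zR[OF n] R0[OF n] x])
      also have "\<dots> \<le> kern x 1 * ((1 / s - 1) * \<phi> 1)"
        using elim(1) kern_nonneg[OF x zero_le_one] by (intro mult_left_mono) auto
      also have "\<dots> = (1 / s - 1) * (\<phi> 1 * kern x 1)" by (simp only: mult_ac)
      also have "\<dots> \<le> (1 / s - 1) * \<rho> x"
        using s s1 by (intro mult_left_mono \<rho>_lower x) simp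
      finally have "\<rho> x \<le> \<rho> x / s - (LINT z|half_line. kern x z * ?R n z)"
        by (simp add: left_diff_distrib)
      then have "?\<epsilon> * \<rho> x \<le> (LINT z|half_line. kern x z * D z (?w n z))"
        unfolding eq by (rule mult_left_mono) simp
      then show ?thesis by (simp add: T_eq[OF w_meas[OF n] x] del: of_nat_Suc)
    qed
    then show ?case using w_meas[OF n] by blast
  qed
  show ?thesis
    by (intro exI[of _ \<rho>] exI[of _ C] conjI allI impI \<rho>_pos \<rho>_upper ev)
qed

end


subsection \<open>Supersolutions and convergence\<close>

context offspring
begin

text \<open>The constant is c = 1 - T f(1), since \<open>kern 1 z\<close> is min(1,z) for z \<ge> 0.
  It is positive because D is positive wherever z > 0 and f < 1.\<close>

lemma T_below_kern:
  assumes f: "f \<in> meas_funs" and pos: "emeasure lebesgue {x \<in> {0..}. f x < 1} > 0"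
  shows "\<exists>c>0. \<forall>x\<ge>0. T f x \<le> 1 - c * kern x 1"
proof -
  let ?d = "\<lambda>z. D z (f z)"
  have notAE: "\<not> (AE z in half_line. ?d z = 0)"
  proof
    assume "AE z in half_line. ?d z = 0"
    with AE_half_line_pos have AE: "AE z in half_line. \<not> f z < 1"
    proof eventually_elim
      case (elim z)
      then show ?case using D_pos[OF elim(1), of "f z"] meas_funsD(2)[OF f, of z] by auto
    qed
    have "{x \<in> {0..}. f x < 1} \<in> sets half_line"
      using meas_funsD(1)[OF f] borel_measurable_iff_less[of f half_line] by simp
    with AE have "emeasure half_line {x \<in> {0..}. f x < 1} = 0"
      by (subst (asm) AE_iff_measurable) auto
    then show False using pos by (subst (asm) emeasure_restrict_space) auto
  qed
  have "(LINT z|half_line. kern 1 z * ?d z) \<noteq> 0"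
    using T_less_1[OF f notAE zero_le_one] by (simp add: T_eq[OF f])
  moreover have "0 \<le> (LINT z|half_line. kern 1 z * ?d z)"
    by (rule half_line_integral_nonneg[OF kern_D_bounds(1)[OF f zero_le_one]])
  ultimately have c: "0 < (LINT z|half_line. kern 1 z * ?d z)" by simp
  have eq: "(LINT z|half_line. kern 1 z * ?d z) = (LINT z|half_line. min 1 z * ?d z)"
    by (rule half_line_integral_cong) (simp add: kern_mult[of 1, simplified])
  show ?thesis
  proof (intro exI conjI allI impI, rule c)
    fix x :: real assume x: "x \<ge> 0"
    show "T f x \<le> 1 - (LINT z|half_line. kern 1 z * ?d z) * kern x 1"
      using kern_integral_lower[OF D_fun_props(4,2)[OF f] x]
      by (simp add: T_eq[OF f x] eq mult.commute)
  qed
qed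

text \<open>Both defects have the profile \<open>kern x 1\<close>: that of w is at most C/(n+1)
  times it and that of T f at least c times it, so any large n with C \<le> c(n+1) works. Only T f,
  not f itself, is placed below w.\<close>

lemma dominating_supersolution:
  assumes beta: "beta0 P > 1" and f: "f \<in> meas_funs"
    and pos: "emeasure lebesgue {x \<in> {0..}. f x < 1} > 0"
  shows "\<exists>w\<in>meas_funs. \<forall>x\<ge>0. T w x \<le> w x \<and> w x < 1 \<and> T f x \<le> w x"
proof -
  obtain \<rho> C where \<rho>: "\<forall>x\<ge>0. 0 < \<rho> x \<and> \<rho> x \<le> C * kern x 1"
    and ev: "\<forall>\<^sub>F n in sequentially. (\<lambda>x\<in>{0..}. 1 - \<rho> x / real (Suc n)) \<in> meas_funs \<and>
      (\<forall>x\<ge>0. T (\<lambda>x\<in>{0..}. 1 - \<rho> x / real (Suc n)) x \<le> 1 - \<rho> x / real (Suc n))"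
    using supersolutions_near_1[OF beta] by (elim exE conjE)
  obtain c where c: "c > 0" "\<forall>x\<ge>0. T f x \<le> 1 - c * kern x 1"
    using T_below_kern[OF f pos] by (elim exE conjE)
  obtain n0 :: nat where n0: "C / c \<le> real n0" using real_arch_simple by blast
  from eventually_conj[OF ev eventually_ge_at_top[of n0]]
  obtain n where n: "n0 \<le> n" "(\<lambda>x\<in>{0..}. 1 - \<rho> x / real (Suc n)) \<in> meas_funs"
    "\<forall>x\<ge>0. T (\<lambda>x\<in>{0..}. 1 - \<rho> x / real (Suc n)) x \<le> 1 - \<rho> x / real (Suc n)"
    unfolding eventually_sequentially by blast
  have "C / c \<le> real (Suc n)" using n0 n(1) by linarith
  then have Cn: "C \<le> c * real (Suc n)" using c(1) by (simp add: field_simps)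
  show ?thesis
  proof (intro bexI[OF _ n(2)] allI impI conjI)
    fix x :: real assume x: "x \<ge> 0"
    let ?w = "\<lambda>x\<in>{0..}. 1 - \<rho> x / real (Suc n)"
    note \<rho>x = \<rho>[rule_format, OF x]
    have w: "?w x = 1 - \<rho> x / real (Suc n)" using x by simp
    show "T ?w x \<le> ?w x" unfolding w using n(3) x by blast
    show "?w x < 1" unfolding w using \<rho>x by simp
    have "\<rho> x \<le> c * real (Suc n) * kern x 1"
      using \<rho>x mult_right_mono[OF Cn kern_nonneg[OF x zero_le_one]] by linarith
    then have "\<rho> x / real (Suc n) \<le> c * kern x 1"
      by (subst pos_divide_le_eq) (simp_all add: mult_ac del: of_nat_Suc)
    then show "T f x \<le> ?w x" unfolding w using c(2)[rule_format, OF x] by linarith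
  qed
qed

lemma supersolution_limit:
  assumes beta: "beta0 P > 1" and w: "w \<in> meas_funs" and sup: "\<forall>x\<ge>0. T w x \<le> w x \<and> w x < 1"
  shows "smallest_fixed_point P \<noteq> (\<lambda>x\<in>{0..}. 1)"
    and "x \<ge> 0 \<Longrightarrow> (\<lambda>l. (T ^^ l) w x) \<longlonglongrightarrow> smallest_fixed_point P x"
proof -
  have dec: "decseq (\<lambda>l. (T ^^ l) w x)" if "x \<ge> 0" for x
  proof (rule decseq_SucI)
    fix l
    have "(T ^^ l) (T w) x \<le> (T ^^ l) w x"
      by (rule T_pow_mono[OF T_meas_funs[OF w] w _ that]) (use sup in blast)
    then show "(T ^^ Suc l) w x \<le> (T ^^ l) w x" by (simp add: funpow_swap1)
  qed
  then have "monoseq (\<lambda>l. (T ^^ l) w x)" if "x \<ge> 0" for x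
    using that by (simp add: monoseq_iff)
  from T_pow_monotone_limit[OF w this]
  obtain v where v: "v \<in> fixed_points P" and lim: "\<forall>x\<ge>0. (\<lambda>l. (T ^^ l) w x) \<longlonglongrightarrow> v x" ..
  have v1: "v x < 1" if x: "x \<ge> 0" for x
    using decseq_ge[OF dec[OF x] lim[rule_format, OF x], of 0] sup x by fastforce
  have ne: "v \<noteq> (\<lambda>x\<in>{0..}. 1)" using v1[of 0] by auto
  obtain k where k: "2 \<le> k" "p k > 0" using ex_p_ge_2_pos[OF beta] by blast
  have "v = smallest_fixed_point P" by (rule fixed_point_unique[OF k v ne])
  with ne lim show "smallest_fixed_point P \<noteq> (\<lambda>x\<in>{0..}. 1)"
    "x \<ge> 0 \<Longrightarrow> (\<lambda>l. (T ^^ l) w x) \<longlonglongrightarrow> smallest_fixed_point P x" by auto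
qed

text \<open>One supersolution below 1 is enough; the zero function is a convenient f with which to
  obtain it.\<close>

lemma smallest_fixed_point_neq_one:
  assumes beta: "beta0 P > 1"
  shows "smallest_fixed_point P \<noteq> (\<lambda>x\<in>{0..}. 1)"
proof -
  let ?z = "\<lambda>x\<in>{0::real..}. 0 :: real"
  have z: "?z \<in> meas_funs" by (rule const_meas_funs) auto
  have eq: "{x \<in> {0..}. ?z x < 1} = {0..}" by auto
  have "emeasure lebesgue {0::real..1} \<le> emeasure lebesgue {0::real..}"
    by (rule emeasure_mono) auto
  then have "1 \<le> emeasure lebesgue {0::real..}" by simp
  then have "emeasure lebesgue {x \<in> {0..}. ?z x < 1} > 0"
    unfolding eq by (rule less_le_trans[OF zero_less_one])
  from dominating_supersolution[OF beta z this]
  obtain w where "w \<in> meas_funs" "\<forall>x\<ge>0. T w x \<le> w x \<and> w x < 1 \<and> T ?z x \<le> w x" ..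
  then show ?thesis by (intro supersolution_limit(1)[OF beta]) auto
qed

lemma T_pow_tendsto_smallest:
  assumes beta: "beta0 P > 1" and f: "f \<in> meas_funs"
    and pos: "emeasure lebesgue {x \<in> {0..}. f x < 1} > 0" and x: "x \<ge> 0"
  shows "(\<lambda>l. (T ^^ l) f x) \<longlonglongrightarrow> smallest_fixed_point P x"
proof -
  let ?z = "\<lambda>x\<in>{0::real..}. 0 :: real"
  have z: "?z \<in> meas_funs" by (rule const_meas_funs) auto
  from dominating_supersolution[OF beta f pos]
  obtain w where w: "w \<in> meas_funs" and sup: "\<forall>x\<ge>0. T w x \<le> w x \<and> w x < 1 \<and> T f x \<le> w x" ..
  from sup have sup': "\<forall>x\<ge>0. T w x \<le> w x \<and> w x < 1" by blast
  note Tf = T_meas_funs[OF f]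
  have lower: "(T ^^ l) ?z x \<le> (T ^^ l) (T f) x" for l
    by (rule T_pow_mono[OF z Tf _ x]) (use meas_funsD(2)[OF Tf] in simp)
  have upper: "(T ^^ l) (T f) x \<le> (T ^^ l) w x" for l
    by (rule T_pow_mono[OF Tf w _ x]) (use sup in blast)
  \<comment> \<open>The squeeze is applied to the iterates of T f, since f may exceed w; the index
    shift is undone at the end.\<close>
  have "(\<lambda>l. (T ^^ l) (T f) x) \<longlonglongrightarrow> smallest_fixed_point P x"
    by (rule tendsto_sandwich[OF always_eventually always_eventually
          smallest_fixed_point_props(3)[OF x] supersolution_limit(2)[OF beta w sup' x]])
      (use lower upper in blast)+
  then have "(\<lambda>l. (T ^^ Suc l) f x) \<longlonglongrightarrow> smallest_fixed_point P x"
    by (simp add: funpow_swap1)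
  then show ?thesis by (rule LIMSEQ_imp_Suc)
qed

lemma fixed_points_eq:
  assumes beta: "beta0 P > 1"
  shows "fixed_points P = {smallest_fixed_point P, (\<lambda>x\<in>{0..}. 1)}"
proof -
  obtain k where k: "2 \<le> k" "p k > 0" using ex_p_ge_2_pos[OF beta] by blast
  show ?thesis
    using fixed_point_unique[OF k] smallest_fixed_point_props(1) one_fixed_point by blast
qed

end

theorem lemma5p25:
  fixes P :: "nat pmf"
  assumes "0 \<notin> set_pmf P"
    and "pmf P 1 < 1"
    and "\<exists>\<theta>>0. integrable (measure_pmf P) (\<lambda>n. exp (\<theta> * real n))"
    and "beta0 P > 1"
  shows "smallest_fixed_point P \<noteq> (\<lambda>x\<in>{0..}. 1) \<and>
    fixed_points P = {smallest_fixed_point P, (\<lambda>x\<in>{0..}. 1)} \<and>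
    (\<forall>f\<in>meas_funs. emeasure lebesgue {x \<in> {0..}. f x < 1} > 0 \<longrightarrow>
      (\<forall>x\<ge>0. (\<lambda>l. (T_op P ^^ l) f x) \<longlonglongrightarrow> smallest_fixed_point P x))"
proof -
  interpret offspring P
    using assms(1-3) by (rule offspring.intro)
  show ?thesis
    using smallest_fixed_point_neq_one[OF assms(4)] fixed_points_eq[OF assms(4)]
      T_pow_tendsto_smallest[OF assms(4)] by blast
qed

end
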